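(* Let $K,T\ge 1$ be integers and let $y_1,\dots,y_T\in\{e_1,\dots,e_K\}$ be an arbitrary fixed (oblivious) sequence of outcomes. Let $S_T$ be the number of distinct outcomes among $y_1,\dots,y_T$. Let $c_0=0$, $c_t=\sum_{s\le t}y_s$, and let the forecasts be those of Dirichlet Follow-the-Leader: $P_1=(1/K,\dots,1/K)$ and, for $2\le t\le T$, $P_t\sim\operatorname{Dir}(c_{t-1})$ drawn independently of past draws. Let $\mathcal L$ be the set of all proper losses $\ell:\Delta_K\times\{e_1,\dots,e_K\}\to[-1,1]$. With $q_T=\frac1T\sum_{t=1}^T y_t$ and $f_\ell(p)=\sum_{i=1}^K p_i\,\ell(p,e_i)$, put $$\operatorname{Reg}_\ell(T)=\mathbb E\sum_{t=1}^T\ell(P_t,y_t)-T f_\ell(q_T),\qquad \operatorname{PUCal}_T=\sup_{\ell\in\mathcal L}\operatorname{Reg}_\ell(T).$$ Then $$\operatorname{PUCal}_T\le 4\sqrt{S_T\,T}\le 4\sqrt{\min\{K,T\}\,T}.$$ Simultaneously (for the same forecasts), for every $\beta\ge 0$ and every $\beta$-smooth $\ell\in\mathcal L$, $$\operatorname{Reg}_\ell(T)\le\tfrac52\,\beta H_T\le\tfrac52\,\beta\,(1+\log T),\qquad H_T=\sum_{t=1}^T\frac1t .$$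
   Context: $\Delta_K=\{p\in\mathbb R^K: p_i\ge 0,\ \sum_i p_i=1\}$ is the probability simplex with vertices $e_1,\dots,e_K$ (standard basis vectors). A loss $\ell:\Delta_K\times\{e_1,\dots,e_K\}\to[-1,1]$ is proper if for every $p\in\Delta_K$, $p$ is a minimizer over $q\in\Delta_K$ of $\sum_{i=1}^K p_i\,\ell(q,e_i)$. The expectation in $\operatorname{Reg}_\ell$ is over the random forecasts $P_t$; it is implicit that losses are measurable in the first argument so that these expectations are defined. For a nonzero vector $\alpha\in[0,\infty)^K$ let $A=\{i:\alpha_i>0\}$. The law $\operatorname{Dir}(\alpha)$ is the distribution of the random vector $P\in\Delta_K$ obtained by drawing independent $G_i\sim\mathrm{Gamma}(\alpha_i,1)$ for $i\in A$, setting $P_i=G_i/\sum_{k\in A}G_k$ for $i\in A$ and $P_i=0$ for $i\notin A$ (so it is supported on the face spanned by $\{e_i:i\in A\}$; if $A=\{i\}$ it is the point mass at $e_i$). A loss $\ell$ is $\beta$-smooth if for each outcome $y$ the map $p\mapsto\ell(p,y)$ is differentiable on $\Delta_K$ and $$\ell(q,y)-\ell(p,y)\le\langle\nabla_p\ell(p,y),q-p\rangle+\frac\beta2\|q-p\|_2^2\qquad\text{for all }p,q\in\Delta_K\text{ and all outcomes }y.$$ Gradients and differentiability on the closed simplex are understood relative to its affine hull, including one-sided differentiability on boundary faces: at each $p\in\Delta_K$ there is a linear functional $\langle\nabla_p\ell(p,y),\cdot\rangle$ on $\{v\in\mathbb R^K:\sum_i v_i=0\}$ with $\ell(q,y)-\ell(p,y)=\langle\nabla_p\ell(p,y),q-p\rangle+o(\|q-p\|_2)$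 as $q\to p$, $q\in\Delta_K$. *)

theory Defs
  imports "HOL-Probability.Probability"
begin

definition prob_simplex :: "(real ^ 'k::finite) set" where
  "prob_simplex = {p. (\<forall>i. 0 \<le> p $ i) \<and> (\<Sum>i\<in>UNIV. p $ i) = 1}"

definition outcomes :: "(real ^ 'k::finite) set" where
  "outcomes = range (\<lambda>i. axis i 1)"

definition gamma_density :: "real \<Rightarrow> real \<Rightarrow> real" where
  "gamma_density a x = (if 0 < x then x powr (a - 1) * exp (- x) / Gamma a else 0)"

definition gamma_measure :: "real \<Rightarrow> real measure" where
  "gamma_measure a = density lborel (\<lambda>x. ennreal (gamma_density a x))"

text \<open>
  The law is a Borel measure on the whole space; it is concentrated on the simplex, since the
  normalising sum is positive almost surely. It is meaningful for nonzero \<open>\<alpha>\<close> with nonnegative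
  entries; shapes may vanish, in which case the law lives on a proper face.
\<close>

definition dirichlet :: "real ^ 'k::finite \<Rightarrow> (real ^ 'k) measure" where
  "dirichlet \<alpha> =
    (let A = {i. \<alpha> $ i > 0} in
      distr (PiM A (\<lambda>i. gamma_measure (\<alpha> $ i))) borel
        (\<lambda>g. \<chi> i. if i \<in> A then g i / (\<Sum>k\<in>A. g k) else 0))"

definition outcome_count :: "(nat \<Rightarrow> real ^ 'k::finite) \<Rightarrow> nat \<Rightarrow> real ^ 'k" where
  "outcome_count y t = (\<Sum>s=1..t. y s)"

definition num_distinct :: "(nat \<Rightarrow> real ^ 'k::finite) \<Rightarrow> nat \<Rightarrow> nat" where
  "num_distinct y T = card (y ` {1..T})"

text \<open>
  Losses are total functions, but only their values on \<open>prob_simplex \<times> outcomes\<close> are constrained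
  or ever used.
\<close>

definition expected_loss ::
    "(real ^ 'k::finite \<Rightarrow> real ^ 'k \<Rightarrow> real) \<Rightarrow> real ^ 'k \<Rightarrow> real ^ 'k \<Rightarrow> real" where
  "expected_loss loss p q = (\<Sum>i\<in>UNIV. p $ i * loss q (axis i 1))"

definition proper_losses :: "(real ^ 'k::finite \<Rightarrow> real ^ 'k \<Rightarrow> real) set" where
  "proper_losses = {loss.
     (\<forall>p\<in>prob_simplex. \<forall>e\<in>outcomes. loss p e \<in> {-1..1}) \<and>
     (\<forall>e\<in>outcomes. (\<lambda>p. loss p e) \<in> borel_measurable (restrict_space borel prob_simplex)) \<and>
     (\<forall>p\<in>prob_simplex. \<forall>q\<in>prob_simplex. expected_loss loss p p \<le> expected_loss loss p q)}"

text \<open>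
  The derivative is taken within the simplex, hence one-sided on the boundary. The gradient
  \<open>g\<close> is then determined only up to a multiple of the all-ones vector, to which the differences
  \<open>q - p\<close> are orthogonal.
\<close>

definition smooth_loss ::
    "real \<Rightarrow> (real ^ 'k::finite \<Rightarrow> real ^ 'k \<Rightarrow> real) \<Rightarrow> bool" where
  "smooth_loss \<beta> loss \<longleftrightarrow>
     (\<forall>e\<in>outcomes. \<forall>p\<in>prob_simplex. \<exists>g.
        ((\<lambda>q. loss q e) has_derivative (\<lambda>v. g \<bullet> v)) (at p within prob_simplex) \<and>
        (\<forall>q\<in>prob_simplex. loss q e - loss p e \<le> g \<bullet> (q - p) + \<beta> / 2 * (norm (q - p))\<^sup>2))"

text \<open>
  \<open>P t\<close> is the forecast of round \<open>t\<close>, as a simplex-valued random variable on the probability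
  space \<open>M\<close>; rounds are numbered from 1 to \<open>T\<close>.
\<close>

definition dirichlet_ftl ::
    "'a measure \<Rightarrow> (nat \<Rightarrow> real ^ 'k::finite) \<Rightarrow> nat \<Rightarrow> (nat \<Rightarrow> 'a \<Rightarrow> real ^ 'k) \<Rightarrow> bool" where
  "dirichlet_ftl M y T P \<longleftrightarrow>
     prob_space M \<and>
     (\<forall>t\<in>{1..T}. P t \<in> measurable M (restrict_space borel prob_simplex)) \<and>
     (\<forall>\<omega>\<in>space M. P 1 \<omega> = (\<chi> i. 1 / real CARD('k))) \<and>
     (\<forall>t\<in>{2..T}. distr M borel (P t) = dirichlet (outcome_count y (t - 1))) \<and>
     prob_space.indep_vars M (\<lambda>_. borel) P {1..T}"

definition regret ::
    "'a measure \<Rightarrow> (nat \<Rightarrow> 'a \<Rightarrow> real ^ 'k::finite) \<Rightarrow> (nat \<Rightarrow> real ^ 'k) \<Rightarrow> nat \<Rightarrow>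
      (real ^ 'k \<Rightarrow> real ^ 'k \<Rightarrow> real) \<Rightarrow> real" where
  "regret M P y T loss =
     (let q = (1 / real T) *\<^sub>R (\<Sum>t=1..T. y t) in
       (\<integral>\<omega>. (\<Sum>t=1..T. loss (P t \<omega>) (y t)) \<partial>M) - real T * expected_loss loss q q)"

definition PUCal ::
    "'a measure \<Rightarrow> (nat \<Rightarrow> 'a \<Rightarrow> real ^ 'k::finite) \<Rightarrow> (nat \<Rightarrow> real ^ 'k) \<Rightarrow> nat \<Rightarrow> ereal" where
  "PUCal M P y T = (SUP loss\<in>proper_losses. ereal (regret M P y T loss))"

end

theory Submission
  imports Defs
begin

text \<open>
  A Dirichlet vector with integer parameters \<open>c\<close> is \<open>G / |G|\<close> for a vector \<open>G\<close> of independent Gamma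
  variables of shapes \<open>c i\<close>, and the next outcome \<open>i\<close> adds an independent exponential \<open>Z\<close> to \<open>G i\<close>.
  Let \<open>F\<close> be the cumulative loss of the best fixed forecast, which is concave and homogeneous.
  Be-the-leader gives \<open>F (G + Z e\<^sub>i) - F G \<ge> Z * loss (G + Z e\<^sub>i) i\<close>, and since size-biasing \<open>Z\<close> turns
  it into a Gamma variable of shape 2, the expected right-hand side is the expected loss at parameters
  \<open>c + 2 e\<^sub>i\<close>. Summing over rounds and using Jensen, the regret is at most the sum of the changes
  of the expected loss from parameters \<open>c\<close> to \<open>c + 2 e\<^sub>i\<close>. The density of shape \<open>n + 1\<close> against shape \<open>n\<close>
  is \<open>x / n\<close>, of variance \<open>1 / n\<close>, so each change is at most \<open>1 / sqrt n + 1 / sqrt (n + 1)\<close> with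
  \<open>n = c i\<close>, and the sum over rounds is bounded by Cauchy-Schwarz.

  For a \<open>\<beta>\<close>-smooth loss, properness bounds the Bregman divergence of the Bayes risk by
  \<open>\<beta> / 2 * |p - q|\<^sup>2\<close>. A round with \<open>n\<close> past outcomes of empirical law \<open>q\<close> then costs at most
  \<open>\<beta> / (2 (n + 1))\<close> for the variance of the forecast, whose mean is \<open>q\<close>, and \<open>2 * \<beta> / (n + 1)\<close> for
  replacing \<open>q\<close> by the updated empirical law.
\<close>

section \<open>Products of Gamma laws\<close>

text \<open>The Gamma law of rate 1, for natural shapes. Taking shape 0 to be the point mass at 0
  lets vectors with vanishing parameters live on one common space and keeps shapes additive.\<close>

definition gamma_law :: "nat \<Rightarrow> real measure" where
  "gamma_law n = (if n = 0 then return borel 0 else density lborel (erlang_density (n - 1) 1))"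

lemma gamma_law_0: "gamma_law 0 = return borel 0"
  by (simp add: gamma_law_def)

lemma gamma_law_Suc: "gamma_law (Suc n) = density lborel (erlang_density n 1)"
  by (simp add: gamma_law_def)

lemma sets_gamma_law [simp, measurable_cong]: "sets (gamma_law n) = sets borel"
  by (simp add: gamma_law_def)

lemma space_gamma_law [simp]: "space (gamma_law n) = UNIV"
  by (simp add: gamma_law_def)

lemma prob_space_gamma_law: "prob_space (gamma_law n)"
  by (cases n) (auto simp: gamma_law_0 gamma_law_Suc prob_space_return prob_space_erlang_density)

lemma gamma_law_eq_gamma_measure:
  assumes "n > 0"
  shows "gamma_measure (real n) = gamma_law n"
proof -
  obtain m where n: "n = Suc m" using assms gr0_conv_Suc by blast
  have [measurable]: "gamma_density (real (Suc m)) \<in> borel_measurable borel"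
    unfolding gamma_density_def[abs_def] by measurable
  then have [measurable]: "gamma_density (1 + real m) \<in> borel_measurable borel" by (simp add: add.commute)
  have G: "Gamma (1 + real m) = fact m" using Gamma_fact[of m, where 'a = real] by simp
  show ?thesis
    unfolding n gamma_measure_def gamma_law_Suc
  proof (rule density_cong)
    \<comment> \<open>The densities may differ at 0: for shape 1 the Erlang density is 1 there,
      while \<open>gamma_density\<close> is 0.\<close>
    show "AE x in lborel. ennreal (gamma_density (real (Suc m)) x) = ennreal (erlang_density m 1 x)"
      using AE_lborel_singleton[of 0]
      by eventually_elim (auto simp: gamma_density_def erlang_density_def G powr_realpow)
  qed auto
qed

lemma AE_gamma_law_nonneg: "AE x in gamma_law n. 0 \<le> x"
proof (cases n)
  case 0
  have "AE x in return borel (0::real). 0 \<le> x" by (subst AE_return) auto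
  then show ?thesis unfolding 0 gamma_law_0 .
next
  case (Suc m)
  show ?thesis unfolding Suc gamma_law_Suc by (subst AE_density) (auto simp: erlang_density_def)
qed

lemma AE_gamma_law_pos:
  assumes "n > 0"
  shows "AE x in gamma_law n. 0 < x"
proof -
  obtain m where n: "n = Suc m" using assms gr0_conv_Suc by blast
  have "AE x in lborel. ennreal (erlang_density m 1 x) > 0 \<longrightarrow> 0 < x"
    using AE_lborel_singleton[of 0] by eventually_elim (auto simp: erlang_density_def)
  then show ?thesis unfolding n gamma_law_Suc by (simp add: AE_density)
qed

text \<open>Multiplying \<open>x^(n-1) exp (-x) / (n-1)!\<close> by \<open>x / n\<close> gives the
  density of the next shape. This size-biasing is the source of all moments and of the stability
  bound below.\<close>

lemma gamma_law_Suc_density: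
  assumes "n > 0"
  shows "gamma_law (Suc n) = density (gamma_law n) (\<lambda>x. ennreal (x / real n))"
proof -
  obtain m where n: "n = Suc m" using assms gr0_conv_Suc by blast
  have *: "ennreal (erlang_density m 1 x) * ennreal (x / real (Suc m)) = ennreal (erlang_density (Suc m) 1 x)" for x
    by (subst ennreal_mult'[symmetric]) (auto simp: erlang_density_def divide_simps)
  show ?thesis
    unfolding n gamma_law_Suc
    by (subst density_density_eq) (simp_all add: * del: of_nat_Suc)
qed

text \<open>Erlang densities are closed under convolution; a zero shape adds the constant 0. The
  form with iterated integrals can be applied inside a single coordinate of a product.\<close>

lemma nn_integral_gamma_law_add:
  assumes [measurable]: "f \<in> borel_measurable borel"
  shows "(\<integral>\<^sup>+x. f x \<partial>gamma_law (m + n)) = (\<integral>\<^sup>+x. \<integral>\<^sup>+z. f (x + z) \<partial>gamma_law n \<partial>gamma_law m)"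
proof -
  consider "n = 0" | "m = 0" | m' n' where "m = Suc m'" "n = Suc n'"
    by (cases m; cases n) auto
  then show ?thesis
  proof cases
    case 1
    then show ?thesis by (simp add: gamma_law_0 nn_integral_return)
  next
    case 2
    interpret n: prob_space "gamma_law n" by (rule prob_space_gamma_law)
    have [measurable]: "(\<lambda>x. \<integral>\<^sup>+z. f (x + z) \<partial>gamma_law n) \<in> borel_measurable borel"
      by measurable
    show ?thesis unfolding 2 gamma_law_0 by (subst nn_integral_return) auto
  next
    case 3
    interpret m: prob_space "density lborel (erlang_density m' 1)" by (rule prob_space_erlang_density) simp
    interpret n: prob_space "density lborel (erlang_density n' 1)" by (rule prob_space_erlang_density) simp
    have "gamma_law (m + n) = convolution (gamma_law m) (gamma_law n)"
      unfolding 3 add_Suc gamma_law_Suc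
      by (subst convolution_density)
         (auto simp: convolution_erlang_density m.finite_measure_axioms n.finite_measure_axioms gamma_law_Suc)
    then show ?thesis
      using prob_space_gamma_law
      by (simp add: nn_integral_convolution prob_space.finite_measure)
  qed
qed

section \<open>Vectors of independent Gamma variables\<close>

definition gamma_prod :: "('k::finite \<Rightarrow> nat) \<Rightarrow> ('k \<Rightarrow> real) measure" where
  "gamma_prod c = PiM UNIV (\<lambda>i. gamma_law (c i))"

lemma sets_gamma_prod [simp, measurable_cong]: "sets (gamma_prod c) = sets (PiM UNIV (\<lambda>_. borel))"
  unfolding gamma_prod_def by (rule sets_PiM_cong) auto

lemma space_gamma_prod [simp]: "space (gamma_prod c) = UNIV"
  by (simp add: gamma_prod_def space_PiM)

lemma prob_space_gamma_prod: "prob_space (gamma_prod c)"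
  unfolding gamma_prod_def by (intro prob_space_PiM prob_space_gamma_law)

lemma AE_gamma_prod_component:
  "AE x in gamma_law (c i). Q x \<Longrightarrow> AE g in gamma_prod c. Q (g i)"
  unfolding gamma_prod_def by (rule AE_PiM_component) (auto simp: prob_space_gamma_law)

lemma AE_gamma_prod_nonneg: "AE g in gamma_prod c. \<forall>i. 0 \<le> g i"
  by (intro AE_all_countable[THEN iffD2] allI AE_gamma_prod_component AE_gamma_law_nonneg)

lemma AE_gamma_prod_pos: "AE g in gamma_prod c. \<forall>i. if c i = 0 then g i = 0 else 0 < g i"
proof (intro AE_all_countable[THEN iffD2] allI)
  fix i
  show "AE g in gamma_prod c. if c i = 0 then g i = 0 else 0 < g i"
  proof (cases "c i = 0")
    case True
    have "AE x in gamma_law (c i). x = 0"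
      unfolding True gamma_law_0 by (subst AE_return) auto
    from AE_gamma_prod_component[where c=c and i=i and Q="\<lambda>x. x = 0", OF this] show ?thesis using True by simp
  next
    case False
    then have "AE g in gamma_prod c. 0 < g i"
      by (intro AE_gamma_prod_component[where Q="\<lambda>x. 0 < x"] AE_gamma_law_pos) simp
    then show ?thesis using False by simp
  qed
qed

text \<open>Tonelli isolates coordinate \<open>i\<close>: the outer measure does not depend on
  \<open>n\<close>, so a change of one shape becomes a statement about a one-dimensional
  law.\<close>

lemma nn_integral_gamma_prod_split:
  fixes c :: "'k::finite \<Rightarrow> nat"
  assumes f: "f \<in> borel_measurable (PiM UNIV (\<lambda>_. borel))"
  shows "(\<integral>\<^sup>+g. f g \<partial>gamma_prod (c(i := n))) =
    (\<integral>\<^sup>+g. \<integral>\<^sup>+x. f (g(i := x)) \<partial>gamma_law n \<partial>PiM (UNIV - {i}) (\<lambda>j. gamma_law (c j)))"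
proof -
  interpret product_sigma_finite "\<lambda>j. gamma_law ((c(i := n)) j)"
    by (intro product_sigma_finite.intro prob_space_imp_sigma_finite prob_space_gamma_law)
  have U: "(UNIV :: 'k set) = insert i (UNIV - {i})" by auto
  have f': "f \<in> borel_measurable (PiM (insert i (UNIV - {i})) (\<lambda>j. gamma_law ((c(i := n)) j)))"
    using f sets_gamma_prod[of "c(i := n)"] unfolding gamma_prod_def U[symmetric]
    by (simp cong: measurable_cong_sets)
  have P: "PiM (UNIV - {i}) (\<lambda>j. gamma_law ((c(i := n)) j)) = PiM (UNIV - {i}) (\<lambda>j. gamma_law (c j))"
    by (intro PiM_cong) auto
  show ?thesis
    unfolding gamma_prod_def
    by (subst U, subst product_nn_integral_insert[OF _ _ f']) (simp_all only: P fun_upd_same, auto)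
qed

lemma measurable_fun_upd_borel [measurable]:
  fixes i :: "'k::finite"
  assumes [measurable]: "f \<in> measurable M (PiM UNIV (\<lambda>_. borel))" "h \<in> borel_measurable M"
  shows "(\<lambda>x. (f x)(i := h x)) \<in> measurable M (PiM UNIV (\<lambda>_::'k. borel :: real measure))"
  by (rule measurable_PiM_single') (auto simp: fun_upd_def)

text \<open>After splitting off coordinate \<open>i\<close> on both sides, additivity of shapes in
  that coordinate is all that remains.\<close>

lemma gamma_prod_add:
  fixes c :: "'k::finite \<Rightarrow> nat"
  shows "gamma_prod (c(i := c i + m)) =
    distr (gamma_prod c \<Otimes>\<^sub>M gamma_law m) (PiM UNIV (\<lambda>_. borel)) (\<lambda>(g, z). g(i := g i + z))"
proof (rule measure_eqI)
  fix A assume "A \<in> sets (gamma_prod (c(i := c i + m)))"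
  then have A [measurable]: "A \<in> sets (PiM UNIV (\<lambda>_::'k. borel :: real measure))" by simp
  let ?f = "indicator A :: ('k \<Rightarrow> real) \<Rightarrow> ennreal"
  let ?R = "PiM (UNIV - {i}) (\<lambda>j. gamma_law (c j))"
  interpret m: prob_space "gamma_law m" by (rule prob_space_gamma_law)
  have upd: "(\<lambda>y. g(i := y)) \<in> measurable borel (PiM UNIV (\<lambda>_::'k. borel :: real measure))" for g
    by (rule measurable_fun_upd_borel) (auto simp: space_PiM)
  have "emeasure (gamma_prod (c(i := c i + m))) A = (\<integral>\<^sup>+g. ?f g \<partial>gamma_prod (c(i := c i + m)))"
    by simp
  also have "\<dots> = (\<integral>\<^sup>+g. \<integral>\<^sup>+x. ?f (g(i := x)) \<partial>gamma_law (c i + m) \<partial>?R)"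
    by (rule nn_integral_gamma_prod_split) measurable
  also have "\<dots> = (\<integral>\<^sup>+g. \<integral>\<^sup>+x. \<integral>\<^sup>+z. ?f (g(i := x + z)) \<partial>gamma_law m \<partial>gamma_law (c i) \<partial>?R)"
    by (subst nn_integral_gamma_law_add[OF measurable_compose[OF upd borel_measurable_indicator[OF A]]]) (rule refl)
  \<comment> \<open>Reading \<open>c\<close> as \<open>c(i := c i)\<close> lets the splitting lemma
    reassemble the product.\<close>
  also have "\<dots> = (\<integral>\<^sup>+g. \<integral>\<^sup>+z. ?f (g(i := g i + z)) \<partial>gamma_law m \<partial>gamma_prod (c(i := c i)))"
    by (subst nn_integral_gamma_prod_split) simp_all
  also have "\<dots> = (\<integral>\<^sup>+x. ?f ((\<lambda>(g, z). g(i := g i + z)) x) \<partial>(gamma_prod c \<Otimes>\<^sub>M gamma_law m))"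
    by (subst m.nn_integral_fst[symmetric]) simp_all
  also have "\<dots> = (\<integral>\<^sup>+g. ?f g \<partial>distr (gamma_prod c \<Otimes>\<^sub>M gamma_law m) (PiM UNIV (\<lambda>_. borel)) (\<lambda>(g, z). g(i := g i + z)))"
    by (subst nn_integral_distr) simp_all
  finally show "emeasure (gamma_prod (c(i := c i + m))) A = 
    emeasure (distr (gamma_prod c \<Otimes>\<^sub>M gamma_law m) (PiM UNIV (\<lambda>_. borel)) (\<lambda>(g, z). g(i := g i + z))) A"
    by simp
qed simp

text \<open>Size-biasing of the single coordinate \<open>i\<close>, carried to the product by
  splitting off that coordinate.\<close>

lemma gamma_prod_Suc_density:
  fixes c :: "'k::finite \<Rightarrow> nat"
  assumes "c i > 0"
  shows "gamma_prod (c(i := Suc (c i))) = density (gamma_prod c) (\<lambda>g. ennreal (g i / real (c i)))"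
proof (rule measure_eqI)
  fix A assume "A \<in> sets (gamma_prod (c(i := Suc (c i))))"
  then have A [measurable]: "A \<in> sets (PiM UNIV (\<lambda>_::'k. borel :: real measure))" by simp
  let ?f = "indicator A :: ('k \<Rightarrow> real) \<Rightarrow> ennreal"
  let ?R = "PiM (UNIV - {i}) (\<lambda>j. gamma_law (c j))"
  have upd: "(\<lambda>y. g(i := y)) \<in> measurable borel (PiM UNIV (\<lambda>_::'k. borel :: real measure))" for g
    by (rule measurable_fun_upd_borel) (auto simp: space_PiM)
  have ind: "(\<lambda>x. ?f (g(i := x))) \<in> borel_measurable borel" for g
    by (rule measurable_compose[OF upd borel_measurable_indicator[OF A]])
  have "emeasure (gamma_prod (c(i := Suc (c i)))) A = (\<integral>\<^sup>+g. ?f g \<partial>gamma_prod (c(i := Suc (c i))))"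
    by simp
  also have "\<dots> = (\<integral>\<^sup>+g. \<integral>\<^sup>+x. ?f (g(i := x)) \<partial>gamma_law (Suc (c i)) \<partial>?R)"
    by (rule nn_integral_gamma_prod_split) measurable
  also have "\<dots> = (\<integral>\<^sup>+g. \<integral>\<^sup>+x. ennreal (x / real (c i)) * ?f (g(i := x)) \<partial>gamma_law (c i) \<partial>?R)"
    using assms ind by (simp add: gamma_law_Suc_density nn_integral_density)
  also have "\<dots> = (\<integral>\<^sup>+g. ennreal (g i / real (c i)) * ?f g \<partial>gamma_prod (c(i := c i)))"
    by (subst nn_integral_gamma_prod_split) simp_all
  finally show "emeasure (gamma_prod (c(i := Suc (c i)))) A = 
    emeasure (density (gamma_prod c) (\<lambda>g. ennreal (g i / real (c i)))) A"
    by (simp add: emeasure_density)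
qed simp

lemma distr_gamma_prod_component: "distr (gamma_prod c) borel (\<lambda>g. g i) = gamma_law (c i)"
proof -
  have "distr (gamma_prod c) borel (\<lambda>g. g i) = distr (gamma_prod c) (gamma_law (c i)) (\<lambda>g. g i)"
    by (rule distr_cong) auto
  also have "\<dots> = gamma_law (c i)"
    unfolding gamma_prod_def
    by (rule distr_PiM_component[where M="\<lambda>i. gamma_law (c i)"]) (auto simp: prob_space_gamma_law)
  finally show ?thesis .
qed

text \<open>Induction on the total shape: a positive coordinate gives up one unit, which by
  \<open>gamma_prod_add\<close> is an independent exponential, and adding it back raises the shape
  of the sum by one.\<close>

lemma distr_gamma_prod_sum:
  fixes c :: "'k::finite \<Rightarrow> nat"
  shows "distr (gamma_prod c) borel (\<lambda>g. \<Sum>i\<in>UNIV. g i) = gamma_law (\<Sum>i\<in>UNIV. c i)"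
proof (induction "\<Sum>i\<in>UNIV. c i" arbitrary: c)
  case 0
  then have c: "c i = 0" for i by simp
  interpret prob_space "gamma_prod c" by (rule prob_space_gamma_prod)
  have "distr (gamma_prod c) borel (\<lambda>g. \<Sum>i\<in>UNIV. g i) = distr (gamma_prod c) borel (\<lambda>g. 0)"
  proof (rule distr_cong_AE)
    show "AE g in gamma_prod c. (\<Sum>i\<in>UNIV. g i) = 0"
      using AE_gamma_prod_pos[of c] by eventually_elim (simp add: c)
  qed auto
  also have "\<dots> = gamma_law (\<Sum>i\<in>UNIV. c i)" by (simp add: 0[symmetric] gamma_law_0)
  finally show ?case .
next
  case (Suc n)
  then obtain i where "c i \<noteq> 0" by (metis (full_types) nat.distinct(1) sum.neutral)
  define d where "d = c(i := c i - 1)"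
  have c: "c = d(i := d i + 1)" using \<open>c i \<noteq> 0\<close> by (simp add: d_def)
  have sd: "(\<Sum>j\<in>UNIV. c j) = (\<Sum>j\<in>UNIV. d j) + 1"
    by (subst c) (simp add: sum.remove[of UNIV i])
  interpret D: prob_space "gamma_prod d" by (rule prob_space_gamma_prod)
  interpret G: prob_space "gamma_law 1" by (rule prob_space_gamma_law)
  have IH: "distr (gamma_prod d) borel (\<lambda>g. \<Sum>i\<in>UNIV. g i) = gamma_law n"
    using Suc sd by auto
  have upd: "(\<Sum>j\<in>UNIV. (g(i := g i + z)) j) = (\<Sum>j\<in>UNIV. g j) + z" for g :: "'k \<Rightarrow> real" and z
    by (simp add: sum.remove[of UNIV i])
  have "distr (gamma_prod c) borel (\<lambda>g. \<Sum>i\<in>UNIV. g i) =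
    distr (gamma_prod d \<Otimes>\<^sub>M gamma_law 1) borel (\<lambda>x. (\<Sum>j\<in>UNIV. fst x j) + snd x)"
    by (subst c, subst gamma_prod_add, subst distr_distr)
       (auto simp: comp_def case_prod_beta upd simp del: fun_upd_apply)
  also have "\<dots> = gamma_law (n + 1)"
  proof (rule measure_eqI)
    fix A assume "A \<in> sets (distr (gamma_prod d \<Otimes>\<^sub>M gamma_law 1) borel (\<lambda>x. (\<Sum>j\<in>UNIV. fst x j) + snd x))"
    then have [measurable]: "A \<in> sets borel" by simp
    let ?f = "indicator A :: real \<Rightarrow> ennreal"
    have "emeasure (distr (gamma_prod d \<Otimes>\<^sub>M gamma_law 1) borel (\<lambda>x. (\<Sum>j\<in>UNIV. fst x j) + snd x)) A =
      (\<integral>\<^sup>+x. ?f x \<partial>distr (gamma_prod d \<Otimes>\<^sub>M gamma_law 1) borel (\<lambda>x. (\<Sum>j\<in>UNIV. fst x j) + snd x))"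
      by simp
    also have "\<dots> = (\<integral>\<^sup>+g. \<integral>\<^sup>+z. ?f ((\<Sum>j\<in>UNIV. g j) + z) \<partial>gamma_law 1 \<partial>gamma_prod d)"
      by (subst nn_integral_distr, simp, simp, subst G.nn_integral_fst[symmetric]) auto
    also have "\<dots> = (\<integral>\<^sup>+x. \<integral>\<^sup>+z. ?f (x + z) \<partial>gamma_law 1 \<partial>gamma_law n)"
      by (subst IH[symmetric], subst nn_integral_distr) measurable
    also have "\<dots> = emeasure (gamma_law (n + 1)) A"
      by (subst nn_integral_gamma_law_add[symmetric]) auto
    finally show "emeasure (distr (gamma_prod d \<Otimes>\<^sub>M gamma_law 1) borel (\<lambda>x. (\<Sum>j\<in>UNIV. fst x j) + snd x)) A
      = emeasure (gamma_law (n + 1)) A" .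
  qed simp
  finally show ?case using Suc by simp
qed

section \<open>Dirichlet laws as normalised Gamma vectors\<close>

lemma borel_measurable_vec_lambda [measurable]:
  fixes f :: "'k::finite \<Rightarrow> 'a \<Rightarrow> real"
  assumes [measurable]: "\<And>i. f i \<in> borel_measurable M"
  shows "(\<lambda>x. \<chi> i. f i x) \<in> borel_measurable M"
proof -
  have "(\<chi> i. f i x) = (\<Sum>i\<in>UNIV. f i x *\<^sub>R axis i 1)" for x
    by (simp add: vec_eq_iff axis_def if_distrib[of "\<lambda>z. _ * z"] cong: if_cong)
  then show ?thesis by simp
qed

lemma borel_measurable_vec_nth [measurable]: "(\<lambda>x::real^'k::finite. x $ i) \<in> borel_measurable borel"
  by (intro borel_measurable_continuous_onI continuous_intros)

text \<open>At total mass 0 the division yields the zero vector, which lies outside the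
  simplex.\<close>

definition normalise :: "('k::finite \<Rightarrow> real) \<Rightarrow> real ^ 'k" where
  "normalise g = (\<chi> i. g i / (\<Sum>k\<in>UNIV. g k))"

lemma measurable_normalise [measurable]:
  "normalise \<in> borel_measurable (PiM UNIV (\<lambda>_. borel))"
  unfolding normalise_def[abs_def] by measurable

lemma normalise_in_simplex:
  assumes "\<forall>i. 0 \<le> g i" "(\<Sum>k\<in>UNIV. g k) > 0"
  shows "normalise g \<in> prob_simplex"
  using assms by (simp add: normalise_def prob_simplex_def flip: sum_divide_distrib)

text \<open>Coordinates of shape 0 vanish almost surely, so adding them to the support changes
  neither the sum nor the quotients; the product over the support is the image of the full product
  under restriction.\<close>

lemma dirichlet_eq_gamma_prod:
  fixes c :: "'k::finite \<Rightarrow> nat"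
  shows "dirichlet (\<chi> i. real (c i)) = distr (gamma_prod c) borel normalise"
proof -
  define A where "A = {i. c i > 0}"
  have A: "{i. 0 < (\<chi> i. real (c i)) $ i} = A" by (simp add: A_def)
  define N :: "('k \<Rightarrow> real) \<Rightarrow> real ^ 'k"
    where "N = (\<lambda>g. \<chi> i. if i \<in> A then g i / (\<Sum>k\<in>A. g k) else 0)"
  interpret product_prob_space "\<lambda>i. gamma_law (c i)"
    by (intro product_prob_spaceI prob_space_gamma_law)
  have P: "PiM A (\<lambda>i. gamma_measure (real (c i))) = PiM A (\<lambda>i. gamma_law (c i))"
    by (intro PiM_cong) (auto simp: gamma_law_eq_gamma_measure A_def)
  have [measurable]: "N \<in> borel_measurable (PiM A (\<lambda>i. gamma_law (c i)))"
  proof -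
    have [measurable]: "(\<lambda>g. g j) \<in> borel_measurable (PiM A (\<lambda>i. gamma_law (c i)))" if "j \<in> A" for j
      using measurable_component_singleton[OF that, of "\<lambda>i. gamma_law (c i)"]
      by (simp cong: measurable_cong_sets)
    have "(\<lambda>g. if j \<in> A then g j / (\<Sum>k\<in>A. g k) else 0) \<in> borel_measurable (PiM A (\<lambda>i. gamma_law (c i)))" for j
      by (cases "j \<in> A") auto
    then show ?thesis unfolding N_def by (rule borel_measurable_vec_lambda)
  qed
  have "dirichlet (\<chi> i. real (c i)) = distr (PiM A (\<lambda>i. gamma_law (c i))) borel N"
    unfolding dirichlet_def A Let_def N_def by (simp add: P)
  also have "\<dots> = distr (distr (gamma_prod c) (PiM A (\<lambda>i. gamma_law (c i))) (\<lambda>g. restrict g A)) borel N"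
    unfolding gamma_prod_def by (subst distr_restrict[symmetric]) auto
  also have "\<dots> = distr (gamma_prod c) borel (\<lambda>g. N (restrict g A))"
    unfolding gamma_prod_def by (subst distr_distr) (auto simp: comp_def intro!: measurable_restrict_subset)
  also have "\<dots> = distr (gamma_prod c) borel normalise"
  proof (rule distr_cong_AE)
    show "AE g in gamma_prod c. N (restrict g A) = normalise g"
      using AE_gamma_prod_pos[of c]
    proof eventually_elim
      case (elim g)
      have "(\<Sum>k\<in>UNIV. g k) = (\<Sum>k\<in>A. g k)"
        using elim by (intro sum.mono_neutral_right) (auto simp: A_def split: if_splits)
      then show ?case
        using elim by (auto simp: N_def normalise_def vec_eq_iff A_def)
    qed
    have "(\<lambda>g. restrict g A) \<in> gamma_prod c \<rightarrow>\<^sub>M PiM A (\<lambda>i. gamma_law (c i))"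
      unfolding gamma_prod_def by (rule measurable_restrict_subset) simp
    then show "(\<lambda>g. N (restrict g A)) \<in> gamma_prod c \<rightarrow>\<^sub>M borel" by measurable
  qed auto
  finally show ?thesis .
qed

section \<open>Raising one shape by one: moments and total variation\<close>

lemma gamma_prod_shift:
  assumes "c i > 0" and [measurable]: "h \<in> borel_measurable (PiM UNIV (\<lambda>_. borel))"
  shows "integrable (gamma_prod (c(i := Suc (c i)))) h \<longleftrightarrow>
      integrable (gamma_prod c) (\<lambda>g. g i / real (c i) * h g :: real)"
    and "(\<integral>g. h g \<partial>gamma_prod (c(i := Suc (c i)))) = (\<integral>g. g i / real (c i) * h g \<partial>gamma_prod c)"
proof -
  have nn: "AE g in gamma_prod c. 0 \<le> g i / real (c i)"
    using AE_gamma_prod_nonneg[of c] by eventually_elim auto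
  show "integrable (gamma_prod (c(i := Suc (c i)))) h \<longleftrightarrow>
      integrable (gamma_prod c) (\<lambda>g. g i / real (c i) * h g :: real)"
    unfolding gamma_prod_Suc_density[where c=c and i=i, OF assms(1)] by (subst integrable_density) (use nn in auto)
  show "(\<integral>g. h g \<partial>gamma_prod (c(i := Suc (c i)))) = (\<integral>g. g i / real (c i) * h g \<partial>gamma_prod c)"
    unfolding gamma_prod_Suc_density[where c=c and i=i, OF assms(1)] by (subst integral_density) (use nn in auto)
qed

lemma gamma_prod_size_bias:
  assumes "c i > 0" and [measurable]: "h \<in> borel_measurable (PiM UNIV (\<lambda>_. borel))"
    and int: "integrable (gamma_prod (c(i := Suc (c i)))) h"
  shows "integrable (gamma_prod c) (\<lambda>g. g i * h g :: real)"
    and "(\<integral>g. g i * h g \<partial>gamma_prod c) = real (c i) * (\<integral>g. h g \<partial>gamma_prod (c(i := Suc (c i))))"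
proof -
  have eq: "(\<lambda>g. real (c i) * (g i / real (c i) * h g)) = (\<lambda>g. g i * h g)"
    using assms(1) by auto
  have "integrable (gamma_prod c) (\<lambda>g. real (c i) * (g i / real (c i) * h g))"
    by (intro integrable_mult_right gamma_prod_shift(1)[THEN iffD1] assms)
  then show "integrable (gamma_prod c) (\<lambda>g. g i * h g)" by (simp only: eq)
  show "(\<integral>g. g i * h g \<partial>gamma_prod c) = real (c i) * (\<integral>g. h g \<partial>gamma_prod (c(i := Suc (c i))))"
    unfolding gamma_prod_shift(2)[where c=c and i=i, OF assms(1,2)] integral_mult_right_zero[symmetric] eq ..
qed

text \<open>The mean is the normalising constant of size-biasing, seen by taking the weight
  \<open>h = 1\<close>; a coordinate of shape 0 is almost surely 0.\<close>

lemma gamma_prod_mean: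
  shows integrable_gamma_prod_component: "integrable (gamma_prod c) (\<lambda>g. g i)"
    and integral_gamma_prod_component: "(\<integral>g. g i \<partial>gamma_prod c) = real (c i)"
proof -
  have "integrable (gamma_prod c) (\<lambda>g. g i) \<and> (\<integral>g. g i \<partial>gamma_prod c) = real (c i)"
  proof (cases "c i = 0")
    case True
    have "AE g in gamma_prod c. g i = 0"
      using AE_gamma_prod_pos[of c] by eventually_elim (metis True)
    then have "has_bochner_integral (gamma_prod c) (\<lambda>g. g i) 0"
      by (subst has_bochner_integral_cong_AE[where g="\<lambda>_. 0"]) auto
    then show ?thesis using True by (auto simp: has_bochner_integral_iff)
  next
    case False
    interpret prob_space "gamma_prod (c(i := Suc (c i)))" by (rule prob_space_gamma_prod)
    show ?thesis
      using gamma_prod_size_bias[where c=c and i=i and h="\<lambda>_. 1"] False prob_space by auto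
  qed
  then show "integrable (gamma_prod c) (\<lambda>g. g i)" "(\<integral>g. g i \<partial>gamma_prod c) = real (c i)"
    by auto
qed

text \<open>One factor \<open>g i\<close> is absorbed by size-biasing, and the other then has mean
  \<open>c i + 1\<close>.\<close>

lemma gamma_prod_second_moment:
  assumes "c i > 0"
  shows "integrable (gamma_prod c) (\<lambda>g. (g i)\<^sup>2)"
    and "(\<integral>g. (g i)\<^sup>2 \<partial>gamma_prod c) = real (c i) * (real (c i) + 1)"
  using gamma_prod_size_bias[where c=c and i=i and h="\<lambda>g. g i"] assms
    gamma_prod_mean[where c="c(i := Suc (c i))" and i=i]
  by (auto simp: power2_eq_square)

text \<open>The difference is the integral of \<open>(1 - g i / c i) * h g\<close>, where
  \<open>g i / c i\<close> has mean 1 and variance \<open>1 / c i\<close>.\<close>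

lemma gamma_prod_Suc_total_variation:
  assumes "c i > 0" and [measurable]: "h \<in> borel_measurable (PiM UNIV (\<lambda>_. borel))"
    and h: "\<And>g. \<bar>h g\<bar> \<le> 1"
  shows "(\<integral>g. h g \<partial>gamma_prod c) - (\<integral>g. h g \<partial>gamma_prod (c(i := Suc (c i)))) \<le> 1 / sqrt (real (c i))"
proof -
  let ?n = "real (c i)"
  interpret prob_space "gamma_prod c" by (rule prob_space_gamma_prod)
  interpret S: prob_space "gamma_prod (c(i := Suc (c i)))" by (rule prob_space_gamma_prod)
  have n: "?n > 0" using assms by simp
  have ih: "integrable (gamma_prod c) h"
    by (rule integrable_const_bound[of _ 1]) (use h in auto)
  have "integrable (gamma_prod (c(i := Suc (c i)))) h"
    by (rule S.integrable_const_bound[of _ 1]) (use h in auto)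
  then have igh: "integrable (gamma_prod c) (\<lambda>g. g i / ?n * h g)"
    using gamma_prod_shift[where c=c and i=i and h=h] assms by simp
  note ints = gamma_prod_second_moment(1)[where c=c and i=i, OF assms(1)] integrable_gamma_prod_component[where c=c and i=i]
  \<comment> \<open>The weight \<open>sqrt ?n / 2\<close> is chosen so that both summands have
    expectation \<open>1 / (2 * sqrt ?n)\<close>.\<close>
  let ?B = "\<lambda>g. sqrt ?n / 2 * (1 - 2 / ?n * g i + (g i)\<^sup>2 / ?n\<^sup>2) + 1 / (2 * sqrt ?n)"
  have iB: "integrable (gamma_prod c) ?B" using ints by auto
  \<comment> \<open>AM-GM replaces the Cauchy-Schwarz bound \<open>E|X| \<le> sqrt (E X\<^sup>2)\<close> for \<open>X = 1 - g i / c i\<close>, as \<open>E X\<^sup>2 = 1 / c i\<close>.\<close>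
  have pw: "h g - g i / ?n * h g \<le> ?B g" for g
  proof -
    define x where "x = 1 - g i / ?n"
    have "h g - g i / ?n * h g = x * h g" by (simp add: x_def algebra_simps)
    also have "\<dots> \<le> \<bar>x\<bar> * \<bar>h g\<bar>" unfolding abs_mult[symmetric] by simp
    also have "\<dots> \<le> \<bar>x\<bar> * 1" by (intro mult_left_mono h) simp
    also have "\<bar>x\<bar> * 1 \<le> sqrt ?n / 2 * x\<^sup>2 + 1 / (2 * sqrt ?n)"
    proof -
      have "0 \<le> (sqrt ?n * \<bar>x\<bar> - 1)\<^sup>2 / (2 * sqrt ?n)" using n by simp
      also have "\<dots> = sqrt ?n / 2 * x\<^sup>2 + 1 / (2 * sqrt ?n) - \<bar>x\<bar>"
        using n by (simp add: field_simps power2_eq_square)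
      finally show ?thesis by simp
    qed
    also have "x\<^sup>2 = 1 - 2 / ?n * g i + (g i)\<^sup>2 / ?n\<^sup>2"
      by (simp add: x_def power2_eq_square algebra_simps)
    finally show ?thesis .
  qed
  have "(\<integral>g. h g \<partial>gamma_prod c) - (\<integral>g. h g \<partial>gamma_prod (c(i := Suc (c i)))) =
      (\<integral>g. h g - g i / ?n * h g \<partial>gamma_prod c)"
    using assms ih igh by (subst gamma_prod_shift(2)[where c=c and i=i]) auto
  also have "\<dots> \<le> (\<integral>g. ?B g \<partial>gamma_prod c)"
    by (intro integral_mono Bochner_Integration.integrable_diff ih igh iB pw)
  also have "\<dots> = sqrt ?n / 2 * (1 - 2 / ?n * ?n + (?n * (?n + 1)) / ?n\<^sup>2) + 1 / (2 * sqrt ?n)"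
    using ints gamma_prod_second_moment(2)[where c=c and i=i, OF assms(1)]
      integral_gamma_prod_component[where c=c and i=i]
      prob_space
    by simp
  also have "1 - 2 / ?n * ?n + (?n * (?n + 1)) / ?n\<^sup>2 = 1 / ?n"
    using n by (simp add: field_simps power2_eq_square)
  also have "sqrt ?n / 2 * (1 / ?n) + 1 / (2 * sqrt ?n) = 1 / sqrt ?n"
    using n real_sqrt_mult_self[of ?n] by (simp add: field_simps)
  finally show ?thesis .
qed

section \<open>Inverse moments of the total mass and moments of the Dirichlet law\<close>

lemma integral_inverse_gamma_law:
  assumes "n > 0"
  shows "(\<integral>x. 1 / x \<partial>gamma_law (Suc n)) = 1 / real n"
    and "(\<integral>x. 1 / x\<^sup>2 \<partial>gamma_law (Suc (Suc n))) = 1 / (real n * (real n + 1))"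
proof -
  \<comment> \<open>Lowering the shape supplies a factor \<open>x\<close>, which cancels one power
    of \<open>1 / x\<close>.\<close>
  have shift: "(\<integral>x. h x \<partial>gamma_law (Suc m)) = (\<integral>x. x / real m * h x \<partial>gamma_law m)"
    if "m > 0" "h \<in> borel_measurable borel" for m and h :: "real \<Rightarrow> real"
  proof -
    have nn: "AE x in gamma_law m. 0 \<le> x / real m"
      using AE_gamma_law_nonneg[of m] by eventually_elim auto
    show ?thesis
      unfolding gamma_law_Suc_density[OF that(1)] by (subst integral_density) (use nn that in auto)
  qed
  interpret prob_space "gamma_law n" by (rule prob_space_gamma_law)
  have "(\<integral>x. 1 / x \<partial>gamma_law (Suc n)) = (\<integral>x. x / real n * (1 / x) \<partial>gamma_law n)"
    using assms by (subst shift) auto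
  also have "\<dots> = (\<integral>x. 1 / real n \<partial>gamma_law n)"
  proof (rule integral_cong_AE)
    \<comment> \<open>The cancellation requires \<open>x\<close> to be nonzero, which holds almost
      surely at positive shape.\<close>
    show "AE x in gamma_law n. x / real n * (1 / x) = 1 / real n"
      using AE_gamma_law_pos[OF assms] by eventually_elim auto
  qed auto
  finally show *: "(\<integral>x. 1 / x \<partial>gamma_law (Suc n)) = 1 / real n" using prob_space by simp
  have "(\<integral>x. 1 / x\<^sup>2 \<partial>gamma_law (Suc (Suc n))) = (\<integral>x. x / real (Suc n) * (1 / x\<^sup>2) \<partial>gamma_law (Suc n))"
    by (subst shift) auto
  also have "\<dots> = (\<integral>x. (1 / x) * (1 / real (Suc n)) \<partial>gamma_law (Suc n))"
    by (rule Bochner_Integration.integral_cong) (auto simp: power2_eq_square)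
  also have "\<dots> = 1 / real n * (1 / real (Suc n))"
    by (simp only: integral_mult_left_zero *)
  finally show "(\<integral>x. 1 / x\<^sup>2 \<partial>gamma_law (Suc (Suc n))) = 1 / (real n * (real n + 1))"
    by (simp add: field_simps)
qed

lemma integral_gamma_prod_sum:
  assumes [measurable]: "f \<in> borel_measurable borel"
  shows "(\<integral>g. f (\<Sum>k\<in>UNIV. g k) \<partial>gamma_prod c) = (\<integral>x. f x \<partial>gamma_law (\<Sum>k\<in>UNIV. c k) :: real)"
  by (subst distr_gamma_prod_sum[symmetric], subst integral_distr) auto

lemma sum_fun_upd_Suc: "(\<Sum>k\<in>UNIV. (c(i := Suc (c i))) k) = Suc (\<Sum>k\<in>UNIV. c k)" for c :: "'k::finite \<Rightarrow> nat"
  by (simp add: sum.remove[of UNIV i])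

text \<open>Each factor \<open>g i\<close> of the numerator is absorbed by raising shape
  \<open>i\<close>. What remains is an inverse moment of the total mass, a Gamma variable of shape
  \<open>n + 1\<close> or \<open>n + 2\<close>.\<close>

lemma normalise_moments:
  assumes n: "n = (\<Sum>k\<in>UNIV. c k)" "n > 0"
  shows integral_normalise: "(\<integral>g. normalise g $ i \<partial>gamma_prod c) = real (c i) / real n"
    and integral_normalise_square: "(\<integral>g. (normalise g $ i)\<^sup>2 \<partial>gamma_prod c) =
      real (c i) * (real (c i) + 1) / (real n * (real n + 1))"
proof -
  let ?S = "\<lambda>g. \<Sum>k\<in>UNIV. g k :: real"
  let ?c = "c(i := Suc (c i))"
  have "(\<integral>g. normalise g $ i \<partial>gamma_prod c) = real (c i) / real n \<and>
    (\<integral>g. (normalise g $ i)\<^sup>2 \<partial>gamma_prod c) = real (c i) * (real (c i) + 1) / (real n * (real n + 1))"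
  proof (cases "c i = 0")
    case True
    have z: "AE g in gamma_prod c. g i = 0"
      using AE_gamma_prod_pos[of c] by eventually_elim (metis True)
    have "(\<integral>g. normalise g $ i \<partial>gamma_prod c) = (\<integral>g. 0 \<partial>gamma_prod c)"
      by (rule integral_cong_AE) (use z in \<open>auto simp: normalise_def elim!: eventually_mono\<close>)
    moreover have "(\<integral>g. (normalise g $ i)\<^sup>2 \<partial>gamma_prod c) = (\<integral>g. 0 \<partial>gamma_prod c)"
      by (rule integral_cong_AE) (use z in \<open>auto simp: normalise_def elim!: eventually_mono\<close>)
    ultimately show ?thesis using True by simp
  next
    case False
    then have ci: "c i > 0" "?c i > 0" by auto
    have "(\<integral>g. normalise g $ i \<partial>gamma_prod c) = (\<integral>g. real (c i) * (g i / real (c i) * (1 / ?S g)) \<partial>gamma_prod c)"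
      using False by (simp add: normalise_def)
    also have "\<dots> = real (c i) * (\<integral>g. 1 / ?S g \<partial>gamma_prod ?c)"
      unfolding integral_mult_right_zero using ci by (subst gamma_prod_shift(2)[where c=c and i=i]) auto
    also have "\<dots> = real (c i) / real n"
      by (subst integral_gamma_prod_sum[of "\<lambda>x. 1 / x"])
         (use n in \<open>auto simp: sum_fun_upd_Suc integral_inverse_gamma_law simp del: fun_upd_apply\<close>)
    finally have 1: "(\<integral>g. normalise g $ i \<partial>gamma_prod c) = real (c i) / real n" .
    have "(\<integral>g. (normalise g $ i)\<^sup>2 \<partial>gamma_prod c) =
        (\<integral>g. real (c i) * (g i / real (c i) * (g i / (?S g)\<^sup>2)) \<partial>gamma_prod c)"
      using False by (simp add: normalise_def power2_eq_square)
    also have "\<dots> = real (c i) * (\<integral>g. g i / (?S g)\<^sup>2 \<partial>gamma_prod ?c)"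
      unfolding integral_mult_right_zero using ci by (subst gamma_prod_shift(2)[where c=c and i=i]) auto
    also have "(\<integral>g. g i / (?S g)\<^sup>2 \<partial>gamma_prod ?c) =
        (\<integral>g. real (?c i) * (g i / real (?c i) * (1 / (?S g)\<^sup>2)) \<partial>gamma_prod ?c)"
      by simp
    also have "\<dots> = real (?c i) * (\<integral>g. 1 / (?S g)\<^sup>2 \<partial>gamma_prod (?c(i := Suc (?c i))))"
      unfolding integral_mult_right_zero using ci by (subst gamma_prod_shift(2)[where c="?c" and i=i]) auto
    also have "\<dots> = (real (c i) + 1) / (real n * (real n + 1))"
      by (subst integral_gamma_prod_sum[of "\<lambda>x. 1 / x\<^sup>2"], simp, subst sum_fun_upd_Suc,
          subst sum_fun_upd_Suc, subst n(1)[symmetric], subst integral_inverse_gamma_law(2)[OF n(2)]) simp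
    finally show ?thesis using 1 by simp
  qed
  then show "(\<integral>g. normalise g $ i \<partial>gamma_prod c) = real (c i) / real n"
    "(\<integral>g. (normalise g $ i)\<^sup>2 \<partial>gamma_prod c) = real (c i) * (real (c i) + 1) / (real n * (real n + 1))"
    by auto
qed

section \<open>Proper losses and the be-the-leader bound\<close>

lemma closed_prob_simplex: "closed (prob_simplex :: (real ^ 'k::finite) set)"
  unfolding prob_simplex_def
  by (intro closed_Collect_conj closed_Collect_all closed_Collect_le closed_Collect_eq continuous_intros)

lemma convex_prob_simplex: "convex (prob_simplex :: (real ^ 'k::finite) set)"
  unfolding convex_def prob_simplex_def
  by (auto simp: sum.distrib simp flip: sum_distrib_left)

lemma axis_in_prob_simplex: "axis i 1 \<in> prob_simplex"
  by (simp add: prob_simplex_def axis_def)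

lemma prob_simplex_le_1:
  assumes "p \<in> prob_simplex"
  shows "p $ i \<le> 1"
proof -
  have "p $ i \<le> (\<Sum>k\<in>UNIV. p $ k)"
    using assms by (intro member_le_sum) (auto simp: prob_simplex_def)
  then show ?thesis using assms by (simp add: prob_simplex_def)
qed

text \<open>Entries in [0, 1] with sum 1 have squared norm at most 1, and the cross term is
  nonnegative.\<close>

lemma prob_simplex_diff_norm_le:
  fixes p q :: "real ^ 'k::finite"
  assumes "p \<in> prob_simplex" "q \<in> prob_simplex"
  shows "(norm (p - q))\<^sup>2 \<le> 2"
proof -
  have *: "r \<bullet> r \<le> 1" if "r \<in> prob_simplex" for r :: "real ^ 'k"
  proof -
    have "r \<bullet> r \<le> (\<Sum>i\<in>UNIV. r $ i)"
      unfolding inner_vec_def using that prob_simplex_le_1[OF that]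
      by (intro sum_mono) (auto simp: prob_simplex_def mult_left_le)
    then show ?thesis using that by (simp add: prob_simplex_def)
  qed
  have "0 \<le> p \<bullet> q"
    unfolding inner_vec_def using assms by (intro sum_nonneg) (auto simp: prob_simplex_def)
  then show ?thesis
    using *[OF assms(1)] *[OF assms(2)]
    by (simp add: power2_norm_eq_inner inner_diff_left inner_diff_right inner_commute)
qed

lemma nonpos_if_le_small_multiple:
  fixes a b \<epsilon> :: real
  assumes "\<epsilon> > 0" "\<And>s. 0 < s \<Longrightarrow> s \<le> \<epsilon> \<Longrightarrow> a \<le> s * b"
  shows "a \<le> 0"
proof (rule ccontr)
  assume "\<not> a \<le> 0"
  then have a: "a > 0" by simp
  have b: "b > 0" using assms(2)[of \<epsilon>] assms(1) a by (smt (verit) mult_nonneg_nonpos)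
  \<comment> \<open>The choice \<open>s = min \<epsilon> (a / (2 * b))\<close> would give
    \<open>a \<le> a / 2\<close>.\<close>
  have "a \<le> min \<epsilon> (a / (2 * b)) * b" using assms a b by simp
  also have "\<dots> \<le> a / (2 * b) * b" using b by (intro mult_right_mono) auto
  finally show False using a b by simp
qed

text \<open>The price of raising a shape from \<open>n\<close> to \<open>n + 2\<close> in two unit
  steps. At \<open>n = 0\<close> it is the length of the range [-1, 1].\<close>

definition stability :: "nat \<Rightarrow> real" where
  "stability n = (if n = 0 then 2 else 1 / sqrt (real n) + 1 / sqrt (real n + 1))"

locale bounded_proper_loss =
  fixes loss :: "real ^ 'k::finite \<Rightarrow> real ^ 'k \<Rightarrow> real"
  assumes proper_loss: "loss \<in> proper_losses"
begin

text \<open>The extension by 0 makes the loss bounded and Borel measurable on the whole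
  space.\<close>

definition score :: "real ^ 'k \<Rightarrow> 'k \<Rightarrow> real" where
  "score p i = (if p \<in> prob_simplex then loss p (axis i 1) else 0)"

definition scores :: "real ^ 'k \<Rightarrow> real ^ 'k" where
  "scores p = (\<chi> i. score p i)"

text \<open>The function \<open>F\<close> of the overview: total mass times the Bayes risk at the
  normalised vector.\<close>

definition cum_score :: "('k \<Rightarrow> real) \<Rightarrow> real" where
  "cum_score g = (\<Sum>i\<in>UNIV. g i * score (normalise g) i)"

lemma measurable_score [measurable]: "(\<lambda>p. score p i) \<in> borel_measurable borel"
proof -
  have "(\<lambda>p. loss p (axis i 1)) \<in> borel_measurable (restrict_space borel prob_simplex)"
    using proper_loss by (auto simp: proper_losses_def outcomes_def)
  then show ?thesis
    unfolding score_def
    by (subst (asm) measurable_restrict_space_iff[where c=0]) (auto simp: borel_closed closed_prob_simplex)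
qed

lemma abs_score_le: "\<bar>score p i\<bar> \<le> 1"
  using proper_loss by (fastforce simp: score_def proper_losses_def outcomes_def abs_le_iff)

lemma expected_loss_scores:
  "q \<in> prob_simplex \<Longrightarrow> expected_loss loss p q = p \<bullet> scores q"
  by (simp add: expected_loss_def scores_def score_def inner_vec_def)

lemma proper:
  assumes "p \<in> prob_simplex" "q \<in> prob_simplex"
  shows "p \<bullet> scores p \<le> p \<bullet> scores q"
  using assms proper_loss unfolding proper_losses_def
  by (auto simp: expected_loss_scores)

lemma inner_axis_scores: "axis i 1 \<bullet> scores p = score p i"
  by (simp add: inner_axis' scores_def)

lemma measurable_cum_score [measurable]: "cum_score \<in> borel_measurable (PiM UNIV (\<lambda>_. borel))"
  unfolding cum_score_def[abs_def] by measurable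

text \<open>Properness scaled by the total mass. It exhibits \<open>cum_score\<close> as a minimum
  of linear functions of \<open>g\<close>, which is the form in which concavity is used.\<close>

lemma cum_score_le:
  assumes g: "\<forall>i. 0 \<le> g i" and q: "q \<in> prob_simplex"
  shows "cum_score g \<le> (\<Sum>i\<in>UNIV. g i * score q i)"
proof (cases "(\<Sum>k\<in>UNIV. g k) = 0")
  case True
  then have "g i = 0" for i using g by (simp add: sum_nonneg_eq_0_iff)
  then show ?thesis by (simp add: cum_score_def)
next
  case False
  let ?S = "\<Sum>k\<in>UNIV. g k"
  have S: "?S > 0" using False sum_nonneg[of UNIV g] g by auto
  have *: "(\<Sum>i\<in>UNIV. g i * score p i) = ?S * (normalise g \<bullet> scores p)" for p
    using S by (simp add: normalise_def scores_def inner_vec_def sum_distrib_left)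
  show ?thesis
    unfolding cum_score_def * using S proper[OF normalise_in_simplex[OF g S] q] by simp
qed

lemma integrable_score: "integrable (gamma_prod c) (\<lambda>g. score (normalise g) i)"
proof -
  interpret prob_space "gamma_prod c" by (rule prob_space_gamma_prod)
  show ?thesis by (rule integrable_const_bound[of _ 1]) (auto simp: abs_score_le)
qed

lemma integrable_cum_score: "integrable (gamma_prod c) cum_score"
proof (rule Bochner_Integration.integrable_bound)
  show "integrable (gamma_prod c) (\<lambda>g. \<Sum>i\<in>UNIV. g i)"
    by (intro Bochner_Integration.integrable_sum integrable_gamma_prod_component)
  show "AE g in gamma_prod c. norm (cum_score g) \<le> norm (\<Sum>i\<in>UNIV. g i)"
    using AE_gamma_prod_nonneg[of c]
  proof eventually_elim
    case (elim g)
    have "norm (cum_score g) \<le> (\<Sum>i\<in>UNIV. \<bar>g i * score (normalise g) i\<bar>)"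
      unfolding cum_score_def real_norm_def by (rule sum_abs)
    also have "\<dots> \<le> (\<Sum>i\<in>UNIV. g i)"
      using elim abs_score_le by (intro sum_mono) (auto simp: abs_mult mult_left_le)
    finally show ?case by simp
  qed
qed simp

text \<open>Jensen's inequality for \<open>cum_score\<close>: the linear function that touches it at
  the mean vector \<open>c\<close> lies above it, and its expectation is its value at
  \<open>c\<close>.\<close>

lemma integral_cum_score_le:
  assumes "(\<Sum>k\<in>UNIV. c k) > 0"
  shows "(\<integral>g. cum_score g \<partial>gamma_prod c) \<le> cum_score (\<lambda>i. real (c i))"
proof -
  let ?q = "normalise (\<lambda>i. real (c i))"
  have q: "?q \<in> prob_simplex"
    using assms by (intro normalise_in_simplex) (auto simp flip: of_nat_sum)
  have "(\<integral>g. cum_score g \<partial>gamma_prod c) \<le> (\<integral>g. (\<Sum>i\<in>UNIV. g i * score ?q i) \<partial>gamma_prod c)"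
  proof (rule integral_mono_AE)
    show "integrable (gamma_prod c) (\<lambda>g. \<Sum>i\<in>UNIV. g i * score ?q i)"
      by (intro Bochner_Integration.integrable_sum integrable_mult_left integrable_gamma_prod_component)
    show "AE g in gamma_prod c. cum_score g \<le> (\<Sum>i\<in>UNIV. g i * score ?q i)"
      using AE_gamma_prod_nonneg[of c] by eventually_elim (rule cum_score_le[OF _ q])
  qed (rule integrable_cum_score)
  also have "\<dots> = cum_score (\<lambda>i. real (c i))"
    by (simp add: integral_gamma_prod_component integrable_gamma_prod_component cum_score_def)
  finally show ?thesis .
qed

text \<open>The new value is the loss of the new best forecast on \<open>g\<close>, at least
  \<open>cum_score g\<close>, plus its loss on the added mass \<open>z\<close>. If the total mass is
  0, then so is \<open>z\<close>.\<close>

lemma cum_score_increment: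
  assumes g: "\<forall>i. 0 \<le> g i" and z: "0 \<le> z"
  shows "z * score (normalise (g(i := g i + z))) i \<le> cum_score (g(i := g i + z)) - cum_score g"
proof (cases "(\<Sum>k\<in>UNIV. (g(i := g i + z)) k) > 0")
  case True
  let ?g = "g(i := g i + z)"
  have q: "normalise ?g \<in> prob_simplex"
    using g z True by (intro normalise_in_simplex) auto
  have "cum_score ?g = (\<Sum>k\<in>UNIV. g k * score (normalise ?g) k + (if k = i then z * score (normalise ?g) k else 0))"
    unfolding cum_score_def by (intro sum.cong) (auto simp: algebra_simps)
  also have "\<dots> = (\<Sum>k\<in>UNIV. g k * score (normalise ?g) k) + z * score (normalise ?g) i"
    by (simp add: sum.distrib)
  finally show ?thesis using cum_score_le[OF g q] by simp
next
  case False
  have "(\<Sum>k\<in>UNIV. (g(i := g i + z)) k) = (\<Sum>k\<in>UNIV. g k) + z"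
    by (simp add: sum.remove[of UNIV i])
  moreover have "(\<Sum>k\<in>UNIV. g k) \<ge> 0" using g by (intro sum_nonneg) auto
  ultimately have "z = 0" using False z by simp
  then show ?thesis by simp
qed

text \<open>
  Be-the-leader with an exponential increment \<open>z\<close> of coordinate \<open>i\<close>; weighting by \<open>z\<close> turns the
  law \<open>gamma_law 1\<close> of the increment into \<open>gamma_law 2\<close>.
\<close>

lemma be_the_leader_step:
  "(\<integral>g. score (normalise g) i \<partial>gamma_prod (c(i := c i + 2))) \<le>
    (\<integral>g. cum_score g \<partial>gamma_prod (c(i := c i + 1))) - (\<integral>g. cum_score g \<partial>gamma_prod c)"
proof -
  define X :: "('k \<Rightarrow> real) \<times> real \<Rightarrow> 'k \<Rightarrow> real" where "X = (\<lambda>(g, z). g(i := g i + z))"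
  define h where "h = (\<lambda>g. score (normalise g) i)"
  interpret C: prob_space "gamma_prod c" by (rule prob_space_gamma_prod)
  interpret G: prob_space "gamma_law 1" by (rule prob_space_gamma_law)
  interpret G2: prob_space "gamma_law 2" by (rule prob_space_gamma_law)
  let ?D = "gamma_prod c \<Otimes>\<^sub>M gamma_law 1"
  have h [measurable]: "h \<in> borel_measurable (PiM UNIV (\<lambda>_. borel))" unfolding h_def by measurable
  have [measurable]: "X \<in> (PiM UNIV (\<lambda>_. borel) \<Otimes>\<^sub>M borel) \<rightarrow>\<^sub>M PiM UNIV (\<lambda>_. borel)"
    unfolding X_def by measurable
  have [simp]: "measurable (gamma_prod c \<Otimes>\<^sub>M gamma_law m) N = measurable (PiM UNIV (\<lambda>_. borel) \<Otimes>\<^sub>M borel) N" for m and N :: "'x measure"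
    by (intro measurable_cong_sets sets_pair_measure_cong) auto
  have fst: "distr ?D (gamma_prod c) fst = gamma_prod c" by (rule G.distr_pair_fst)
  have snd: "distr ?D (gamma_law 1) snd = gamma_law 1"
  proof (rule measure_eqI)
    fix A assume "A \<in> sets (distr ?D (gamma_law 1) snd)"
    then have A: "A \<in> sets (gamma_law 1)" by simp
    have "snd -` A \<inter> space ?D = space (gamma_prod c) \<times> A"
      using sets.sets_into_space[OF A] by (auto simp: space_pair_measure)
    then show "emeasure (distr ?D (gamma_law 1) snd) A = emeasure (gamma_law 1) A"
      using A by (subst emeasure_distr, simp_all only: measurable_snd sets_distr G.emeasure_pair_measure_Times[OF sets.top A])
         (simp add: C.emeasure_space_1 del: space_gamma_prod)
  qed simp
  have nn_fst: "AE x in ?D. \<forall>j. 0 \<le> fst x j"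
    using AE_gamma_prod_nonneg[of c] by (intro AE_distrD[where M'="gamma_prod c" and f=fst]) (simp_all only: fst measurable_fst)
  have nn_snd: "AE x in ?D. 0 \<le> snd x"
    using AE_gamma_law_nonneg[of 1] by (intro AE_distrD[where M'="gamma_law 1" and f=snd]) (simp_all only: snd measurable_snd)
  have mean1: "integrable (gamma_law 1) (\<lambda>z. z)"
  proof -
    \<comment> \<open>The exponential law is a marginal of the product with all shapes 1 and
      inherits integrability from it.\<close>
    have "integrable (distr (gamma_prod (\<lambda>_. 1)) borel (\<lambda>g. g i)) (\<lambda>z. z)"
      by (subst integrable_distr_eq) (auto intro: integrable_gamma_prod_component)
    then show ?thesis unfolding distr_gamma_prod_component .
  qed
  have F1: "gamma_prod (c(i := c i + m)) = distr (gamma_prod c \<Otimes>\<^sub>M gamma_law m) (PiM UNIV (\<lambda>_. borel)) X" for m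
    unfolding X_def by (rule gamma_prod_add)
  \<comment> \<open>Size-biasing acts on the second factor alone and so passes to the product
    measure.\<close>
  have law2: "gamma_prod c \<Otimes>\<^sub>M gamma_law 2 = density ?D (\<lambda>x. ennreal (snd x))"
  proof -
    have g2: "gamma_law 2 = density (gamma_law 1) (\<lambda>z. ennreal z)"
      using gamma_law_Suc_density[of 1] by (simp add: numeral_2_eq_2)
    have "gamma_prod c \<Otimes>\<^sub>M gamma_law 2 = density (gamma_prod c) (\<lambda>_. 1) \<Otimes>\<^sub>M density (gamma_law 1) (\<lambda>z. ennreal z)"
      by (simp add: density_1 g2)
    also have "\<dots> = density ?D (\<lambda>(g, z). 1 * ennreal z)"
      using G2.sigma_finite_measure_axioms G.sigma_finite_measure_axioms
      by (intro pair_measure_density) (auto simp: g2)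
    finally show ?thesis by (simp add: case_prod_beta')
  qed
  have intX: "integrable ?D (\<lambda>x. cum_score (X x))"
    using integrable_cum_score[of "c(i := c i + 1)"] unfolding F1 by (subst (asm) integrable_distr_eq) auto
  have intfst: "integrable ?D (\<lambda>x. cum_score (fst x))"
    using integrable_cum_score[of c] by (subst (asm) fst[symmetric], subst (asm) integrable_distr_eq) auto
  have intz: "integrable ?D (\<lambda>x. snd x)"
    using mean1 by (subst (asm) snd[symmetric], subst (asm) integrable_distr_eq) auto
  have intzh: "integrable ?D (\<lambda>x. snd x * h (X x))"
    by (rule Bochner_Integration.integrable_bound[OF intz])
       (auto simp: h_def abs_mult mult_left_le abs_score_le)
  have "(\<integral>g. score (normalise g) i \<partial>gamma_prod (c(i := c i + 2))) = (\<integral>x. h (X x) \<partial>(gamma_prod c \<Otimes>\<^sub>M gamma_law 2))"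
    unfolding F1 h_def by (subst integral_distr) auto
  also have "\<dots> = (\<integral>x. snd x * h (X x) \<partial>?D)"
    unfolding law2 by (subst integral_density) (use nn_snd in auto)
  also have "\<dots> \<le> (\<integral>x. cum_score (X x) - cum_score (fst x) \<partial>?D)"
  proof (rule integral_mono_AE)
    show "AE x in ?D. snd x * h (X x) \<le> cum_score (X x) - cum_score (fst x)"
      using nn_fst nn_snd
      by eventually_elim (auto simp: h_def X_def case_prod_beta intro!: cum_score_increment simp del: fun_upd_apply)
  qed (use intX intfst intzh in auto)
  also have "\<dots> = (\<integral>x. cum_score (X x) \<partial>?D) - (\<integral>x. cum_score (fst x) \<partial>?D)"
    by (rule Bochner_Integration.integral_diff[OF intX intfst])
  also have "(\<integral>x. cum_score (X x) \<partial>?D) = (\<integral>g. cum_score g \<partial>gamma_prod (c(i := c i + 1)))"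
    unfolding F1 by (subst integral_distr) auto
  also have "(\<integral>x. cum_score (fst x) \<partial>?D) = (\<integral>g. cum_score g \<partial>gamma_prod c)"
    by (subst (2) fst[symmetric], subst integral_distr) auto
  finally show ?thesis .
qed

text \<open>The total variation bound is applied twice, from shape \<open>c i\<close> to
  \<open>c i + 1\<close> and on to \<open>c i + 2\<close>. At \<open>c i = 0\<close> both integrals
  merely lie in [-1, 1].\<close>

lemma score_stability:
  "(\<integral>g. score (normalise g) i \<partial>gamma_prod c) \<le>
    (\<integral>g. score (normalise g) i \<partial>gamma_prod (c(i := c i + 2))) + stability (c i)"
proof (cases "c i = 0")
  case True
  have *: "\<bar>\<integral>g. score (normalise g) i \<partial>gamma_prod d\<bar> \<le> 1" for d
  proof -
    interpret prob_space "gamma_prod d" by (rule prob_space_gamma_prod)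
    have "norm (\<integral>g. score (normalise g) i \<partial>gamma_prod d) \<le> (\<integral>g. norm (score (normalise g) i) \<partial>gamma_prod d)"
      by simp
    also have "\<dots> \<le> (\<integral>g. 1 \<partial>gamma_prod d)"
      by (intro integral_mono integrable_norm integrable_score) (auto simp: abs_score_le)
    finally show ?thesis using prob_space by simp
  qed
  show ?thesis using *[of c] *[of "c(i := c i + 2)"] True by (simp add: stability_def abs_le_iff)
next
  case False
  let ?d = "c(i := Suc (c i))"
  have "?d(i := Suc (?d i)) = c(i := c i + 2)" by simp
  then show ?thesis
    using gamma_prod_Suc_total_variation[where c=c and i=i and h="\<lambda>g. score (normalise g) i"]
      gamma_prod_Suc_total_variation[where c="?d" and i=i and h="\<lambda>g. score (normalise g) i"] False
    by (auto simp: stability_def abs_score_le add.commute)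
qed

end

section \<open>Smooth proper losses\<close>

context bounded_proper_loss
begin

lemma AE_normalise_in_simplex:
  assumes "(\<Sum>k\<in>UNIV. c k) > 0"
  shows "AE g in gamma_prod c. normalise g \<in> prob_simplex"
  using AE_gamma_prod_pos[of c]
proof eventually_elim
  case (elim g)
  obtain i where i: "c i > 0" using assms by (metis not_gr_zero sum.neutral)
  have nn: "\<forall>j. 0 \<le> g j" using elim by (metis less_eq_real_def)
  moreover have "(\<Sum>k\<in>UNIV. g k) > 0"
    using nn elim[rule_format, of i] i by (intro sum_pos2[where i=i]) auto
  ultimately show ?case by (rule normalise_in_simplex)
qed

context
  fixes \<beta> :: real
  assumes smooth: "smooth_loss \<beta> loss" and beta: "\<beta> \<ge> 0"
begin

lemma score_smooth:
  assumes "p \<in> prob_simplex"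
  obtains G where "\<And>q. q \<in> prob_simplex \<Longrightarrow> score q i - score p i \<le> G \<bullet> (q - p) + \<beta> / 2 * (norm (q - p))\<^sup>2"
  using smooth assms that unfolding smooth_loss_def score_def outcomes_def by fastforce

text \<open>Average the bounds of the single outcomes with weights \<open>w\<close>; the weights sum
  to 1, so the quadratic term is preserved.\<close>

lemma weighted_score_smooth:
  assumes p: "p \<in> prob_simplex" and w: "w \<in> prob_simplex"
  obtains G where "\<And>q. q \<in> prob_simplex \<Longrightarrow>
    w \<bullet> scores q - w \<bullet> scores p \<le> G \<bullet> (q - p) + \<beta> / 2 * (norm (q - p))\<^sup>2"
proof -
  have "\<forall>i. \<exists>G. \<forall>q\<in>prob_simplex. score q i - score p i \<le> G \<bullet> (q - p) + \<beta> / 2 * (norm (q - p))\<^sup>2"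
    using score_smooth[OF p] by metis
  then obtain G where G: "\<And>i q. q \<in> prob_simplex \<Longrightarrow>
      score q i - score p i \<le> G i \<bullet> (q - p) + \<beta> / 2 * (norm (q - p))\<^sup>2"
    by metis
  show thesis
  proof (rule that)
    fix q :: "real ^ 'k" assume q: "q \<in> prob_simplex"
    have "w \<bullet> scores q - w \<bullet> scores p = (\<Sum>i\<in>UNIV. w $ i * (score q i - score p i))"
      by (simp add: inner_vec_def scores_def right_diff_distrib sum_subtractf)
    also have "\<dots> \<le> (\<Sum>i\<in>UNIV. w $ i * (G i \<bullet> (q - p) + \<beta> / 2 * (norm (q - p))\<^sup>2))"
      using w by (intro sum_mono mult_left_mono G q) (auto simp: prob_simplex_def)
    also have "\<dots> = (\<Sum>i\<in>UNIV. w $ i *\<^sub>R G i) \<bullet> (q - p) + (\<Sum>i\<in>UNIV. w $ i) * (\<beta> / 2 * (norm (q - p))\<^sup>2)"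
      by (simp only: inner_sum_left inner_scaleR_left distrib_left sum.distrib sum_distrib_right)
    finally show "w \<bullet> scores q - w \<bullet> scores p \<le>
        (\<Sum>i\<in>UNIV. w $ i *\<^sub>R G i) \<bullet> (q - p) + \<beta> / 2 * (norm (q - p))\<^sup>2"
      using w by (simp add: prob_simplex_def)
  qed
qed

text \<open>
  At a point \<open>r\<close> of the open segment from \<open>p\<close> to \<open>q\<close> one can also move away from \<open>q\<close>, so properness
  at \<open>r\<close> makes the first-order term of the smoothness bound nonpositive; then let \<open>r\<close> tend to \<open>p\<close>.
\<close>

lemma bregman_le:
  assumes p: "p \<in> prob_simplex" and q: "q \<in> prob_simplex"
  shows "p \<bullet> scores q - p \<bullet> scores p \<le> \<beta> / 2 * (norm (q - p))\<^sup>2"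
proof -
  define v where "v = q - p"
  define B where "B = \<beta> / 2 * (norm v)\<^sup>2"
  have B: "B \<ge> 0" using beta by (simp add: B_def)
  have seg: "p + t *\<^sub>R v \<in> prob_simplex" if "0 \<le> t" "t \<le> 1" for t
    using convexD_alt[OF convex_prob_simplex p q that] by (simp add: v_def algebra_simps)
  have "p \<bullet> scores q - p \<bullet> scores p - B \<le> \<epsilon> * (v \<bullet> scores p - v \<bullet> scores q)" if e: "0 < \<epsilon>" "\<epsilon> \<le> 1 / 2" for \<epsilon>
  proof -
    define r where "r = p + \<epsilon> *\<^sub>R v"
    have r: "r \<in> prob_simplex" unfolding r_def using e by (intro seg) auto
    obtain G where G: "\<And>q. q \<in> prob_simplex \<Longrightarrow>
        r \<bullet> scores q - r \<bullet> scores r \<le> G \<bullet> (q - r) + \<beta> / 2 * (norm (q - r))\<^sup>2"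
      using weighted_score_smooth[OF r r] by metis
    have Gv: "G \<bullet> v \<le> 0"
    proof (rule nonpos_if_le_small_multiple[OF e(1)])
      fix s assume s: "0 < s" "s \<le> \<epsilon>"
      \<comment> \<open>A step of size \<open>s\<close> from \<open>r\<close> away from
        \<open>q\<close>, still on the segment because \<open>s \<le> \<epsilon>\<close>.\<close>
      let ?q = "p + (\<epsilon> - s) *\<^sub>R v"
      have q': "?q \<in> prob_simplex" using s e by (intro seg) auto
      have d: "?q - r = - s *\<^sub>R v" by (simp add: r_def algebra_simps)
      have "0 \<le> r \<bullet> scores ?q - r \<bullet> scores r" using proper[OF r q'] by simp
      also have "\<dots> \<le> - s * (G \<bullet> v) + \<beta> / 2 * (s\<^sup>2 * (norm v)\<^sup>2)"
        using G[OF q'] unfolding d by (simp add: power_mult_distrib)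
      finally have "s * (G \<bullet> v) \<le> s * (s * B)"
        by (simp add: B_def power2_eq_square algebra_simps)
      then show "G \<bullet> v \<le> s * B" using s by simp
    qed
    have d: "q - r = (1 - \<epsilon>) *\<^sub>R v" by (simp add: r_def v_def algebra_simps)
    have "r \<bullet> scores q - r \<bullet> scores r \<le> (1 - \<epsilon>) * (G \<bullet> v) + \<beta> / 2 * ((1 - \<epsilon>)\<^sup>2 * (norm v)\<^sup>2)"
      using G[OF q] e unfolding d by (simp add: power_mult_distrib)
    also have "\<dots> \<le> 0 + (1 - \<epsilon>)\<^sup>2 * B"
      using e Gv by (intro add_mono mult_nonneg_nonpos) (auto simp: B_def)
    also have "\<dots> \<le> B"
      using B e by (simp add: mult_left_le_one_le power_le_one)
    \<comment> \<open>Properness at \<open>r\<close> replaces \<open>scores r\<close> by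
      \<open>scores p\<close>. Expanding \<open>r = p + \<epsilon> v\<close> then leaves an error
      linear in \<open>\<epsilon>\<close>.\<close>
    finally have "r \<bullet> scores q - r \<bullet> scores p \<le> B"
      using proper[OF r p] by simp
    then show ?thesis by (simp add: r_def inner_add_left algebra_simps)
  qed
  then have "p \<bullet> scores q - p \<bullet> scores p - B \<le> 0"
    by (intro nonpos_if_le_small_multiple[where \<epsilon>="1 / 2"]) auto
  then show ?thesis by (simp add: B_def v_def)
qed

text \<open>The Bregman bounds in both directions add up to a bound on
  \<open>- (v \<bullet> D)\<close>. As the vertex is \<open>q - v\<close>, the change of its score
  is \<open>q \<bullet> D - v \<bullet> D\<close>, whose first term is nonpositive by
  properness.\<close>

lemma score_towards_axis:
  assumes q: "q \<in> prob_simplex" and d: "0 < \<delta>" "\<delta> \<le> 1"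
  shows "score q i - score (q - \<delta> *\<^sub>R (q - axis i 1)) i \<le> 2 * \<beta> * \<delta>"
proof -
  define v where "v = q - axis i 1"
  define q' where "q' = q - \<delta> *\<^sub>R v"
  define D where "D = scores q - scores q'"
  have q': "q' \<in> prob_simplex"
    using convexD_alt[OF convex_prob_simplex q axis_in_prob_simplex[of i], of \<delta>] d
    by (simp add: q'_def v_def algebra_simps)
  have sq: "(norm (q - q'))\<^sup>2 = \<delta>\<^sup>2 * (norm v)\<^sup>2" "(norm (q' - q))\<^sup>2 = \<delta>\<^sup>2 * (norm v)\<^sup>2"
    by (simp_all add: q'_def power_mult_distrib)
  have "(q' - q) \<bullet> D \<le> \<beta> * (\<delta>\<^sup>2 * (norm v)\<^sup>2)"
    using bregman_le[OF q q'] bregman_le[OF q' q]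
    by (simp add: sq D_def inner_diff_left inner_diff_right)
  moreover have "(q' - q) \<bullet> D = - \<delta> * (v \<bullet> D)" by (simp add: q'_def)
  ultimately have "\<delta> * (- (v \<bullet> D)) \<le> \<delta> * (\<beta> * \<delta> * (norm v)\<^sup>2)"
    by (simp add: power2_eq_square algebra_simps)
  then have vD: "- (v \<bullet> D) \<le> \<beta> * \<delta> * (norm v)\<^sup>2"
    by (rule mult_left_le_imp_le[OF _ d(1)])
  have "(norm v)\<^sup>2 \<le> 2"
    unfolding v_def by (rule prob_simplex_diff_norm_le[OF q axis_in_prob_simplex])
  then have "\<beta> * \<delta> * (norm v)\<^sup>2 \<le> \<beta> * \<delta> * 2"
    using beta d by (intro mult_left_mono) auto
  moreover have "q \<bullet> D \<le> 0" using proper[OF q q'] by (simp add: D_def inner_diff_right)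
  moreover have "score q i - score q' i = q \<bullet> D - v \<bullet> D"
    by (simp add: v_def D_def inner_diff_left inner_diff_right inner_axis_scores)
  ultimately show ?thesis using vD by (simp add: q'_def v_def)
qed

text \<open>The forecast has mean \<open>q\<close>, so the linear term of the smoothness bound
  averages out, and the quadratic term becomes the total variance of the Dirichlet law.\<close>

lemma expected_score_le:
  fixes c :: "'k \<Rightarrow> nat"
  assumes n: "n = (\<Sum>k\<in>UNIV. c k)" "n > 0"
  defines "q \<equiv> normalise (\<lambda>k. real (c k))"
  shows "(\<integral>g. score (normalise g) i \<partial>gamma_prod c) \<le> score q i + \<beta> / 2 * (1 / (real n + 1))"
proof -
  interpret prob_space "gamma_prod c" by (rule prob_space_gamma_prod)
  have rn: "(\<Sum>k\<in>UNIV. real (c k)) = real n" by (simp add: n)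
  have qk: "q $ k = real (c k) / real n" for k by (simp add: q_def normalise_def rn)
  have q: "q \<in> prob_simplex"
    unfolding q_def using n(2) by (intro normalise_in_simplex) (simp_all only: rn, simp_all)
  obtain G where G: "\<And>p. p \<in> prob_simplex \<Longrightarrow> score p i - score q i \<le> G \<bullet> (p - q) + \<beta> / 2 * (norm (p - q))\<^sup>2"
    using score_smooth[OF q] by metis
  have simplex: "AE g in gamma_prod c. normalise g \<in> prob_simplex"
    using n by (intro AE_normalise_in_simplex) simp
  have b: "AE g in gamma_prod c. norm (normalise g $ k) \<le> 1" for k
    using simplex
  proof eventually_elim
    case (elim g)
    then show ?case using prob_simplex_le_1[OF elim, of k] by (simp add: prob_simplex_def)
  qed
  have i1: "integrable (gamma_prod c) (\<lambda>g. normalise g $ k)" for k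
    by (rule integrable_const_bound[OF b]) simp
  have "AE g in gamma_prod c. norm ((normalise g $ k)\<^sup>2) \<le> 1" for k
    using b[of k] by eventually_elim (simp add: abs_square_le_1)
  then have i2: "integrable (gamma_prod c) (\<lambda>g. (normalise g $ k)\<^sup>2)" for k
    by (rule integrable_const_bound) simp
  let ?U = "\<lambda>g. score q i + (\<Sum>k\<in>UNIV. G $ k * (normalise g $ k - q $ k)) +
    \<beta> / 2 * (\<Sum>k\<in>UNIV. (normalise g $ k)\<^sup>2 - 2 * q $ k * (normalise g $ k) + (q $ k)\<^sup>2)"
  have "(\<integral>g. score (normalise g) i \<partial>gamma_prod c) \<le> (\<integral>g. ?U g \<partial>gamma_prod c)"
  proof (rule integral_mono_AE[OF integrable_score])
    show "integrable (gamma_prod c) ?U"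
      using i1 i2 by (intro Bochner_Integration.integrable_add integrable_const integrable_mult_right
          Bochner_Integration.integrable_sum Bochner_Integration.integrable_diff) auto
    show "AE g in gamma_prod c. score (normalise g) i \<le> ?U g"
      using simplex
    proof eventually_elim
      case (elim g)
      have "(norm (normalise g - q))\<^sup>2 = (\<Sum>k\<in>UNIV. (normalise g $ k)\<^sup>2 - 2 * q $ k * (normalise g $ k) + (q $ k)\<^sup>2)"
        unfolding power2_norm_eq_inner inner_vec_def
        by (intro sum.cong) (simp_all add: power2_eq_square algebra_simps)
      then show ?case using G[OF elim] by (simp add: inner_vec_def)
    qed
  qed
  also have "\<dots> = score q i + (\<Sum>k\<in>UNIV. G $ k * (real (c k) / real n - q $ k)) +
    \<beta> / 2 * (\<Sum>k\<in>UNIV. real (c k) * (real (c k) + 1) / (real n * (real n + 1))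
      - 2 * q $ k * (real (c k) / real n) + (q $ k)\<^sup>2)"
    using i1 i2 n prob_space by (simp add: integral_normalise integral_normalise_square)
  also have "\<dots> = score q i + \<beta> / 2 * (\<Sum>k\<in>UNIV. real (c k) * (real (c k) + 1) / (real n * (real n + 1))
      - (real (c k) / real n)\<^sup>2)"
    by (simp add: qk power2_eq_square)
  \<comment> \<open>With \<open>x = c k\<close>, the squared mean \<open>x^2 / n^2\<close> outweighs
    the part \<open>x^2 / (n (n + 1))\<close> of the second moment.\<close>
  also have "\<dots> \<le> score q i + \<beta> / 2 * (\<Sum>k\<in>UNIV. real (c k) / (real n * (real n + 1)))"
  proof (intro add_left_mono mult_left_mono sum_mono)
    fix k
    let ?x = "real (c k)" and ?n = "real n"
    have "?x * (?x + 1) / (?n * (?n + 1)) = ?x * ?x / (?n * (?n + 1)) + ?x / (?n * (?n + 1))"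
      by (simp add: distrib_left add_divide_distrib)
    moreover have "?x * ?x / (?n * (?n + 1)) \<le> ?x * ?x / (?n * ?n)"
      using n(2) by (intro divide_left_mono mult_left_mono mult_pos_pos) auto
    moreover have "?x * ?x / (?n * ?n) = (?x / ?n)\<^sup>2" by (simp add: power2_eq_square)
    ultimately show "?x * (?x + 1) / (?n * (?n + 1)) - (?x / ?n)\<^sup>2 \<le> ?x / (?n * (?n + 1))" by linarith
  qed (use beta in auto)
  also have "(\<Sum>k\<in>UNIV. real (c k) / (real n * (real n + 1))) = 1 / (real n + 1)"
    using n(2) by (simp add: rn flip: sum_divide_distrib)
  finally show ?thesis .
qed

text \<open>One more outcome moves the empirical law by the fraction \<open>1 / (n + 1)\<close>
  towards its vertex. The moved law pays at most the increment of \<open>cum_score\<close>; the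
  variance contributes 1/2 and the move 2 to the constant 5/2.\<close>

lemma smooth_step:
  fixes c :: "'k \<Rightarrow> nat"
  assumes n: "n = (\<Sum>k\<in>UNIV. c k)" "n > 0"
  shows "(\<integral>g. score (normalise g) i \<partial>gamma_prod c) \<le>
    cum_score (\<lambda>k. real ((c(i := c i + 1)) k)) - cum_score (\<lambda>k. real (c k)) + 5 / 2 * \<beta> / (real n + 1)"
proof -
  define \<delta> where "\<delta> = 1 / (real n + 1)"
  define g where "g = (\<lambda>k. real (c k))"
  have d: "0 < \<delta>" "\<delta> \<le> 1" by (auto simp: \<delta>_def)
  have rn: "(\<Sum>k\<in>UNIV. g k) = real n" by (simp add: n g_def)
  have q: "normalise g \<in> prob_simplex"
    using n(2) by (intro normalise_in_simplex) (simp_all only: rn, simp_all add: g_def)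
  have S: "(\<Sum>k\<in>UNIV. (g(i := g i + 1)) k) = real n + 1"
    unfolding rn[symmetric] by (simp add: sum.remove[of UNIV i])
  have "normalise (g(i := g i + 1)) = normalise g - \<delta> *\<^sub>R (normalise g - axis i 1)"
    unfolding normalise_def S rn \<delta>_def using n(2)
    by (auto simp: vec_eq_iff axis_def divide_simps) (auto simp: algebra_simps)
  then have "score (normalise g - \<delta> *\<^sub>R (normalise g - axis i 1)) i \<le> cum_score (g(i := g i + 1)) - cum_score g"
    using cum_score_increment[of g 1 i] by (simp add: g_def)
  moreover have "(\<lambda>k. real ((c(i := c i + 1)) k)) = g(i := g i + 1)" by (auto simp: g_def)
  moreover have "(\<integral>g. score (normalise g) i \<partial>gamma_prod c) \<le> score (normalise g) i + \<beta> / 2 * \<delta>"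
    using expected_score_le[OF n, of i] unfolding \<delta>_def g_def .
  moreover have "5 / 2 * \<beta> / (real n + 1) = 5 / 2 * \<beta> * \<delta>"
    by (simp add: \<delta>_def)
  ultimately show ?thesis
    using score_towards_axis[OF q d, of i] unfolding g_def[symmetric] by simp
qed

text \<open>The first round has no past law, so the Bregman bound is used at the vertex itself, with
  squared diameter 2.\<close>

lemma smooth_first_step:
  assumes "p \<in> prob_simplex"
  shows "score p i \<le> score (axis i 1) i + \<beta>"
proof -
  have "score p i - score (axis i 1) i \<le> \<beta> / 2 * (norm (p - axis i 1))\<^sup>2"
    using bregman_le[OF axis_in_prob_simplex assms, of i] by (simp add: inner_axis_scores)
  also have "\<dots> \<le> \<beta> / 2 * 2"
    using beta by (intro mult_left_mono prob_simplex_diff_norm_le[OF assms axis_in_prob_simplex]) auto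
  finally show ?thesis by simp
qed

end

end

section \<open>The regret bounds\<close>

text \<open>Outcomes are tracked by their indices, and counts are naturals so that they can serve as
  Gamma shapes.\<close>

definition visit_count :: "(nat \<Rightarrow> 'k) \<Rightarrow> nat \<Rightarrow> 'k \<Rightarrow> nat" where
  "visit_count Y t i = card {s\<in>{1..t}. Y s = i}"

lemma visit_count_0: "visit_count Y 0 = (\<lambda>_. 0)"
  by (simp add: visit_count_def fun_eq_iff)

lemma visit_count_Suc:
  "visit_count Y (Suc t) = (visit_count Y t)(Y (Suc t) := visit_count Y t (Y (Suc t)) + 1)"
proof
  fix i
  have "{s\<in>{1..Suc t}. Y s = i} = (if Y (Suc t) = i then insert (Suc t) {s\<in>{1..t}. Y s = i} else {s\<in>{1..t}. Y s = i})"
    by (auto simp: le_Suc_eq)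
  then show "visit_count Y (Suc t) i = ((visit_count Y t)(Y (Suc t) := visit_count Y t (Y (Suc t)) + 1)) i"
    by (auto simp: visit_count_def)
qed

lemma sum_visit_count: "(\<Sum>i\<in>UNIV. visit_count Y t i) = t" for Y :: "nat \<Rightarrow> 'k::finite"
proof (induction t)
  case (Suc t)
  then show ?case unfolding visit_count_Suc Suc_eq_plus1[symmetric] by (simp only: sum_fun_upd_Suc)
qed (simp add: visit_count_0)

lemma visit_count_pos_iff: "visit_count Y t i > 0 \<longleftrightarrow> i \<in> Y ` {1..t}"
  by (auto simp: visit_count_def card_gt_0_iff)

lemma outcome_count_eq_visit_count:
  fixes y :: "nat \<Rightarrow> real ^ 'k::finite"
  assumes "\<And>s. s \<in> {1..t} \<Longrightarrow> y s = axis (Y s) 1"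
  shows "outcome_count y t = (\<chi> i. real (visit_count Y t i))"
proof -
  have "(\<Sum>s=1..t. axis (Y s) 1 :: real ^ 'k) $ i = (\<Sum>s=1..t. if Y s = i then 1 else 0)" for i
    by (simp add: axis_def eq_commute[of i])
  also have "\<dots> i = real (visit_count Y t i)" for i
    by (simp add: visit_count_def flip: sum.inter_filter)
  finally have "(\<Sum>s=1..t. axis (Y s) 1 :: real ^ 'k) $ i = real (visit_count Y t i)" for i .
  moreover have "outcome_count y t = (\<Sum>s=1..t. axis (Y s) 1)"
    unfolding outcome_count_def using assms by (intro sum.cong) auto
  ultimately show ?thesis by (simp add: vec_eq_iff)
qed

section \<open>Summation of the stability costs\<close>

text \<open>
  A bound by \<open>4 * sqrt n\<close> itself is not inductive, since for \<open>n > 0\<close> \<open>stability n\<close> exceeds the increment of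
  \<open>4 * sqrt n\<close>.
\<close>

definition stability_potential :: "nat \<Rightarrow> real" where
  "stability_potential n = (if n = 0 then 0 else 2 * sqrt (real n) + 2 * sqrt (real n - 1))"

text \<open>A discrete form of \<open>(2 sqrt x)' = 1 / sqrt x\<close>, from the nonnegativity of
  the squared difference of the roots.\<close>

lemma inverse_sqrt_le:
  fixes x :: real
  assumes "x \<ge> 0"
  shows "1 / sqrt (x + 1) \<le> 2 * (sqrt (x + 1) - sqrt x)"
proof -
  have p: "sqrt (x + 1) > 0" using assms by simp
  have "0 \<le> (sqrt (x + 1) - sqrt x)\<^sup>2" by simp
  also have "\<dots> = 2 * (sqrt (x + 1) - sqrt x) * sqrt (x + 1) - 1"
    using assms by (simp add: power2_eq_square algebra_simps)
  finally show ?thesis using p by (simp add: divide_le_eq)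
qed

text \<open>The two terms of \<open>stability\<close> are bounded by the increments of
  \<open>2 * sqrt\<close> from \<open>n - 1\<close> to \<open>n\<close> and from \<open>n\<close> to
  \<open>n + 1\<close>; at \<open>n = 0\<close> equality holds.\<close>

lemma stability_le_potential_increment:
  "stability n \<le> stability_potential (Suc n) - stability_potential n"
proof (cases "n = 0")
  case False
  have "1 / sqrt (real n) \<le> 2 * (sqrt (real n) - sqrt (real n - 1))"
    using inverse_sqrt_le[of "real n - 1"] False by simp
  moreover have "1 / sqrt (real n + 1) \<le> 2 * (sqrt (real n + 1) - sqrt (real n))"
    by (rule inverse_sqrt_le) simp
  ultimately show ?thesis using False by (simp add: stability_def stability_potential_def add.commute)
qed (simp add: stability_def stability_potential_def)

lemma stability_potential_le: "stability_potential n \<le> 4 * sqrt (real n)"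
  by (auto simp: stability_potential_def)

lemma sum_stability_le_potential:
  fixes Y :: "nat \<Rightarrow> 'k::finite"
  shows "(\<Sum>s<T. stability (visit_count Y s (Y (Suc s)))) \<le> (\<Sum>i\<in>UNIV. stability_potential (visit_count Y T i))"
proof (induction T)
  case (Suc T)
  let ?i = "Y (Suc T)" and ?c = "visit_count Y T"
  have "(\<Sum>i\<in>UNIV. stability_potential (visit_count Y (Suc T) i)) =
      (\<Sum>i\<in>UNIV. stability_potential (?c i)) + (stability_potential (Suc (?c ?i)) - stability_potential (?c ?i))"
    by (simp add: visit_count_Suc sum.remove[of UNIV ?i])
  then show ?case using Suc stability_le_potential_increment[of "?c ?i"] by simp
qed (simp add: visit_count_0 stability_potential_def)

lemma sum_sqrt_le:
  assumes "\<And>i. i \<in> A \<Longrightarrow> 0 \<le> x i"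
  shows "(\<Sum>i\<in>A. sqrt (x i)) \<le> sqrt (real (card A) * (\<Sum>i\<in>A. x i))"
proof (rule real_le_rsqrt)
  have "(\<Sum>i\<in>A. 1 * sqrt (x i))\<^sup>2 \<le> (\<Sum>i\<in>A. 1\<^sup>2) * (\<Sum>i\<in>A. (sqrt (x i))\<^sup>2)"
    by (rule Cauchy_Schwarz_ineq_sum)
  then show "(\<Sum>i\<in>A. sqrt (x i))\<^sup>2 \<le> real (card A) * (\<Sum>i\<in>A. x i)"
    using assms by simp
qed

lemma sum_stability_le:
  fixes Y :: "nat \<Rightarrow> 'k::finite"
  shows "(\<Sum>s<T. stability (visit_count Y s (Y (Suc s)))) \<le> 4 * sqrt (real (card (Y ` {1..T})) * real T)"
proof -
  let ?A = "Y ` {1..T}" and ?c = "visit_count Y T"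
  have z: "?c i = 0" if "i \<notin> ?A" for i using visit_count_pos_iff[of Y T i] that by simp
  have "(\<Sum>s<T. stability (visit_count Y s (Y (Suc s)))) \<le> (\<Sum>i\<in>UNIV. 4 * sqrt (real (?c i)))"
    by (intro order.trans[OF sum_stability_le_potential] sum_mono stability_potential_le)
  \<comment> \<open>Restricting to the outcomes that occur before Cauchy-Schwarz gives their number
    as the factor, instead of the dimension.\<close>
  also have "\<dots> = 4 * (\<Sum>i\<in>?A. sqrt (real (?c i)))"
    unfolding sum_distrib_left using z by (intro sum.mono_neutral_right) auto
  also have "\<dots> \<le> 4 * sqrt (real (card ?A) * (\<Sum>i\<in>?A. real (?c i)))"
    by (intro mult_left_mono sum_sqrt_le) auto
  also have "(\<Sum>i\<in>?A. real (?c i)) = (\<Sum>i\<in>UNIV. real (?c i))"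
    using z by (intro sum.mono_neutral_left) auto
  also have "\<dots> = real T"
    by (simp add: sum_visit_count flip: of_nat_sum)
  finally show ?thesis .
qed

section \<open>From single rounds to the regret\<close>

context bounded_proper_loss
begin

text \<open>The index \<open>s\<close> counts past outcomes, so it stands for round
  \<open>s + 1\<close>; \<open>s = 0\<close> is the uniform first forecast.\<close>

definition round_score :: "(nat \<Rightarrow> 'k) \<Rightarrow> nat \<Rightarrow> real" where
  "round_score Y s = (if s = 0 then score (\<chi> i. 1 / real CARD('k)) (Y 1)
     else (\<integral>g. score (normalise g) (Y (Suc s)) \<partial>gamma_prod (visit_count Y s)))"

lemma cum_score_zero: "cum_score (\<lambda>_. 0) = 0"
  by (simp add: cum_score_def)

lemma integral_cum_score_zero: "(\<integral>g. cum_score g \<partial>gamma_prod (\<lambda>_. 0)) = 0"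
proof -
  have "(\<integral>g. cum_score g \<partial>gamma_prod (\<lambda>_. 0)) = (\<integral>g. 0 \<partial>gamma_prod (\<lambda>_ :: 'k. 0))"
  proof (rule integral_cong_AE)
    show "AE g in gamma_prod (\<lambda>_. 0). cum_score g = 0"
      using AE_gamma_prod_pos[of "\<lambda>_. 0"] by eventually_elim (simp add: cum_score_def)
  qed auto
  then show ?thesis by simp
qed

lemma uniform_in_prob_simplex: "(\<chi> i. 1 / real CARD('k)) \<in> (prob_simplex :: (real ^ 'k) set)"
  by (simp add: prob_simplex_def)

text \<open>Linearity of expectation splits the loss into rounds, each evaluated under the law of
  its forecast. The comparator is \<open>cum_score\<close> at the final counts by
  homogeneity.\<close>

lemma regret_eq:
  fixes M :: "'a measure" and y :: "nat \<Rightarrow> real ^ 'k" and P :: "nat \<Rightarrow> 'a \<Rightarrow> real ^ 'k"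
  assumes T: "T \<ge> 1" and y: "\<And>t. t \<in> {1..T} \<Longrightarrow> y t = axis (Y t) 1"
    and ftl: "dirichlet_ftl M y T P"
  shows "regret M P y T loss = (\<Sum>s<T. round_score Y s) - cum_score (\<lambda>i. real (visit_count Y T i))"
proof -
  interpret M: prob_space M using ftl by (simp add: dirichlet_ftl_def)
  have Pm: "P t \<in> M \<rightarrow>\<^sub>M restrict_space borel prob_simplex" if "t \<in> {1..T}" for t
    using ftl that by (simp add: dirichlet_ftl_def)
  have PM: "P t \<in> borel_measurable M" if "t \<in> {1..T}" for t
    using Pm[OF that] by (rule measurable_restrict_space2_iff[THEN iffD1, THEN conjunct1])
  have Ps: "P t \<omega> \<in> prob_simplex" if "t \<in> {1..T}" "\<omega> \<in> space M" for t \<omega>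
    using measurable_space[OF Pm[OF that(1)] that(2)] by (simp add: space_restrict_space)
  have sm: "(\<lambda>\<omega>. score (P t \<omega>) i) \<in> borel_measurable M" if "t \<in> {1..T}" for t i
    by (rule measurable_compose[OF PM[OF that] measurable_score])
  have int: "integrable M (\<lambda>\<omega>. score (P t \<omega>) i)" if "t \<in> {1..T}" for t i
    by (rule M.integrable_const_bound[of _ 1]) (use sm[OF that] abs_score_le in auto)
  have round: "(\<integral>\<omega>. score (P (Suc s) \<omega>) (Y (Suc s)) \<partial>M) = round_score Y s" if s: "s < T" for s
  proof (cases "s = 0")
    case True
    have "(\<integral>\<omega>. score (P (Suc s) \<omega>) (Y (Suc s)) \<partial>M) = (\<integral>\<omega>. score (\<chi> i. 1 / real CARD('k)) (Y 1) \<partial>M)"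
      using ftl True by (intro Bochner_Integration.integral_cong) (auto simp: dirichlet_ftl_def)
    then show ?thesis using True M.prob_space by (simp add: round_score_def)
  next
    case False
    have "distr M borel (P (Suc s)) = dirichlet (outcome_count y s)"
      using ftl s False by (auto simp: dirichlet_ftl_def dest!: bspec[of _ _ "Suc s"])
    also have "\<dots> = distr (gamma_prod (visit_count Y s)) borel normalise"
      using y s by (subst outcome_count_eq_visit_count[where Y=Y]) (auto simp: dirichlet_eq_gamma_prod)
    finally have D: "distr M borel (P (Suc s)) = distr (gamma_prod (visit_count Y s)) borel normalise" .
    have "(\<integral>\<omega>. score (P (Suc s) \<omega>) (Y (Suc s)) \<partial>M) = (\<integral>p. score p (Y (Suc s)) \<partial>distr M borel (P (Suc s)))"
      using PM s by (subst integral_distr) auto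
    also have "\<dots> = (\<integral>g. score (normalise g) (Y (Suc s)) \<partial>gamma_prod (visit_count Y s))"
      unfolding D by (subst integral_distr) auto
    finally show ?thesis using False by (simp add: round_score_def)
  qed
  have "(\<integral>\<omega>. (\<Sum>t=1..T. loss (P t \<omega>) (y t)) \<partial>M) = (\<integral>\<omega>. (\<Sum>t=1..T. score (P t \<omega>) (Y t)) \<partial>M)"
    by (intro Bochner_Integration.integral_cong sum.cong refl) (simp add: y Ps score_def)
  also have "\<dots> = (\<Sum>t=1..T. \<integral>\<omega>. score (P t \<omega>) (Y t) \<partial>M)"
    by (rule Bochner_Integration.integral_sum) (rule int)
  also have "\<dots> = (\<Sum>s<T. round_score Y s)"
    unfolding One_nat_def sum.atLeast1_atMost_eq by (intro sum.cong round) auto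
  finally have E: "(\<integral>\<omega>. (\<Sum>t=1..T. loss (P t \<omega>) (y t)) \<partial>M) = (\<Sum>s<T. round_score Y s)" .
  let ?g = "\<lambda>i. real (visit_count Y T i)"
  have S: "(\<Sum>i\<in>UNIV. ?g i) = real T" by (simp add: sum_visit_count flip: of_nat_sum)
  have q: "(1 / real T) *\<^sub>R (\<Sum>t=1..T. y t) = normalise ?g"
    using outcome_count_eq_visit_count[of T y Y, OF y]
    by (simp add: outcome_count_def normalise_def S vec_eq_iff)
  have simplex: "normalise ?g \<in> prob_simplex"
    using T by (intro normalise_in_simplex) (simp_all only: S, simp_all)
  have "real T * expected_loss loss (normalise ?g) (normalise ?g) = cum_score ?g"
    unfolding expected_loss_scores[OF simplex] cum_score_def inner_vec_def sum_distrib_left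
    using T by (intro sum.cong) (simp_all add: scores_def, simp add: normalise_def S)
  then show ?thesis unfolding regret_def Let_def q E by simp
qed

text \<open>Stability passes to two extra units of shape, where be-the-leader bounds the round by an
  increment of the expected \<open>cum_score\<close>. These increments telescope.\<close>

lemma round_scores_le:
  assumes T: "T \<ge> 1"
  shows "(\<Sum>s<T. round_score Y s) - cum_score (\<lambda>i. real (visit_count Y T i)) \<le>
    4 * sqrt (real (card (Y ` {1..T})) * real T)"
proof -
  let ?c = "visit_count Y"
  let ?\<Phi> = "\<lambda>t. \<integral>g. cum_score g \<partial>gamma_prod (?c t)"
  let ?i = "\<lambda>s. Y (Suc s)"
  have step: "round_score Y s \<le> (?\<Phi> (Suc s) - ?\<Phi> s) + stability (?c s (?i s))" for s
  proof -
    let ?I = "\<lambda>c. \<integral>g. score (normalise g) (?i s) \<partial>gamma_prod c"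
    have "round_score Y s \<le> ?I ((?c s)(?i s := ?c s (?i s) + 2)) + stability (?c s (?i s))"
    proof (cases "s = 0")
      \<comment> \<open>The first forecast is not a Dirichlet draw; two values in [-1, 1] differ by
        at most \<open>stability 0 = 2\<close>.\<close>
      case True
      interpret prob_space "gamma_prod ((?c s)(?i s := ?c s (?i s) + 2))" by (rule prob_space_gamma_prod)
      have "(\<integral>g. - 1 \<partial>gamma_prod ((?c s)(?i s := ?c s (?i s) + 2))) \<le> ?I ((?c s)(?i s := ?c s (?i s) + 2))"
        using abs_score_le by (intro integral_mono integrable_score integrable_const) (auto simp: abs_le_iff minus_le_iff)
      moreover have "round_score Y s \<le> 1"
        using True abs_score_le by (auto simp: round_score_def abs_le_iff)
      ultimately show ?thesis using True prob_space by (simp add: stability_def visit_count_0)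
    next
      case False
      then show ?thesis using score_stability[where i="?i s" and c="?c s"] by (simp add: round_score_def)
    qed
    then show ?thesis
      using be_the_leader_step[where i="?i s" and c="?c s"] by (simp add: visit_count_Suc)
  qed
  have "(\<Sum>s<T. round_score Y s) \<le> (\<Sum>s<T. (?\<Phi> (Suc s) - ?\<Phi> s) + stability (?c s (?i s)))"
    by (intro sum_mono step)
  also have "\<dots> = ?\<Phi> T - ?\<Phi> 0 + (\<Sum>s<T. stability (?c s (?i s)))"
    by (simp only: sum.distrib sum_lessThan_telescope[of ?\<Phi> T])
  \<comment> \<open>Jensen's inequality at time \<open>T\<close> turns the averaged potential into
    the comparator.\<close>
  also have "\<dots> \<le> cum_score (\<lambda>i. real (?c T i)) - 0 + 4 * sqrt (real (card (Y ` {1..T})) * real T)"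
    using T by (intro add_mono diff_mono integral_cum_score_le sum_stability_le)
      (simp_all add: visit_count_0 integral_cum_score_zero sum_visit_count)
  finally show ?thesis by simp
qed

text \<open>Here the potential is \<open>cum_score\<close> at the counts themselves, so it
  telescopes exactly to the comparator and leaves the errors \<open>1 / (s + 1)\<close>.\<close>

lemma round_scores_smooth_le:
  assumes smooth: "smooth_loss \<beta> loss" "\<beta> \<ge> 0"
  shows "(\<Sum>s<T. round_score Y s) - cum_score (\<lambda>i. real (visit_count Y T i)) \<le> 5 / 2 * \<beta> * harm T"
proof -
  let ?F = "\<lambda>t. cum_score (\<lambda>i. real (visit_count Y t i))"
  have step: "round_score Y s \<le> (?F (Suc s) - ?F s) + 5 / 2 * \<beta> / (real s + 1)" for s
  proof (cases "s = 0")
    case True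
    \<comment> \<open>The first increment starts from the zero vector, so the updated empirical law
      is the vertex of the first outcome.\<close>
    have n: "normalise ((\<lambda>_. 0)(Y 1 := 0 + 1)) = axis (Y 1) 1"
      by (simp add: normalise_def axis_def vec_eq_iff)
    have v: "(\<lambda>i. real (visit_count Y (Suc 0) i)) = (\<lambda>_. 0)(Y 1 := 0 + 1)"
      by (auto simp: visit_count_Suc visit_count_0)
    have "round_score Y s \<le> score (axis (Y 1) 1) (Y 1) + \<beta>"
      using smooth_first_step[OF smooth uniform_in_prob_simplex] True by (simp add: round_score_def)
    moreover have "score (axis (Y 1) 1) (Y 1) \<le> ?F (Suc 0) - ?F 0"
      using cum_score_increment[of "\<lambda>_. 0" 1 "Y 1"] n v by (simp add: visit_count_0)
    ultimately show ?thesis using True smooth by simp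
  next
    case False
    then show ?thesis
      using smooth_step[OF smooth, of s "visit_count Y s" "Y (Suc s)"]
      by (simp add: round_score_def sum_visit_count visit_count_Suc)
  qed
  have "(\<Sum>s<T. round_score Y s) \<le> (\<Sum>s<T. (?F (Suc s) - ?F s) + 5 / 2 * \<beta> / (real s + 1))"
    by (intro sum_mono step)
  also have "\<dots> = ?F T - ?F 0 + (\<Sum>s<T. 5 / 2 * \<beta> / (real s + 1))"
    by (simp only: sum.distrib sum_lessThan_telescope[of ?F T])
  also have "(\<Sum>s<T. 5 / 2 * \<beta> / (real s + 1)) = 5 / 2 * \<beta> * harm T"
    unfolding harm_def One_nat_def sum.atLeast1_atMost_eq sum_distrib_left
    by (intro sum.cong) (auto simp: field_simps)
  finally show ?thesis by (simp add: visit_count_0 cum_score_zero)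
qed

end

theorem theorem1:
  fixes M :: "'a measure"
    and y :: "nat \<Rightarrow> real ^ 'k::finite"
    and P :: "nat \<Rightarrow> 'a \<Rightarrow> real ^ 'k"
    and T :: nat
  assumes "T \<ge> 1"
    and "\<And>t. t \<in> {1..T} \<Longrightarrow> y t \<in> outcomes"
    and "dirichlet_ftl M y T P"
  shows "PUCal M P y T \<le> ereal (4 * sqrt (real (num_distinct y T) * real T)) \<and>
    4 * sqrt (real (num_distinct y T) * real T) \<le> 4 * sqrt (real (min CARD('k) T) * real T) \<and>
    (\<forall>\<beta>\<ge>0. \<forall>loss\<in>proper_losses. smooth_loss \<beta> loss \<longrightarrow>
      regret M P y T loss \<le> 5 / 2 * \<beta> * harm T \<and>
      5 / 2 * \<beta> * harm T \<le> 5 / 2 * \<beta> * (1 + ln (real T)))"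
proof -
  have "\<forall>t\<in>{1..T}. \<exists>i. y t = axis i 1"
    using assms(2) unfolding outcomes_def by blast
  then obtain Y where Y: "\<And>t. t \<in> {1..T} \<Longrightarrow> y t = axis (Y t) 1"
    by metis
  have "y ` {1..T} = (\<lambda>i. axis i 1) ` (Y ` {1..T})"
    using Y by (simp add: image_image)
  then have distinct: "num_distinct y T = card (Y ` {1..T})"
    unfolding num_distinct_def by (simp add: card_image inj_on_def axis_eq_axis)
  have regret: "regret M P y T loss =
      (\<Sum>s<T. bounded_proper_loss.round_score loss Y s) -
      bounded_proper_loss.cum_score loss (\<lambda>i. real (visit_count Y T i))"
    if "loss \<in> proper_losses" for loss
    by (rule bounded_proper_loss.regret_eq[OF bounded_proper_loss.intro[OF that] assms(1) Y assms(3)])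
  have "PUCal M P y T \<le> ereal (4 * sqrt (real (num_distinct y T) * real T))"
    unfolding PUCal_def
  proof (rule SUP_least)
    fix loss :: "real ^ 'k \<Rightarrow> real ^ 'k \<Rightarrow> real" assume l: "loss \<in> proper_losses"
    show "ereal (regret M P y T loss) \<le> ereal (4 * sqrt (real (num_distinct y T) * real T))"
      unfolding distinct regret[OF l]
      using bounded_proper_loss.round_scores_le[OF bounded_proper_loss.intro[OF l] assms(1)] by simp
  qed
  moreover have "num_distinct y T \<le> min CARD('k) T"
    unfolding distinct using card_image_le[of "{1..T}" Y] by (simp add: card_mono)
  then have "4 * sqrt (real (num_distinct y T) * real T) \<le> 4 * sqrt (real (min CARD('k) T) * real T)"
    by (intro mult_left_mono real_sqrt_le_mono mult_right_mono of_nat_mono) auto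
  moreover have "regret M P y T loss \<le> 5 / 2 * \<beta> * harm T"
    if "\<beta> \<ge> 0" "loss \<in> proper_losses" "smooth_loss \<beta> loss" for \<beta> loss
    unfolding regret[OF that(2)]
    by (rule bounded_proper_loss.round_scores_smooth_le[OF bounded_proper_loss.intro[OF that(2)] that(3,1)])
  \<comment> \<open>The sequence \<open>harm n - ln n\<close> decreases from its value 1 at
    \<open>n = 1\<close>.\<close>
  moreover have "harm T \<le> 1 + ln (real T)"
    using euler_mascheroni_sequence_decreasing[of 1 T] assms(1) by (simp add: harm_def)
  then have "5 / 2 * \<beta> * harm T \<le> 5 / 2 * \<beta> * (1 + ln (real T))" if "\<beta> \<ge> 0" for \<beta>
    using that by (intro mult_left_mono) auto
  ultimately show ?thesis by blast
qed

end
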